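(* Let $(\mathbb{R},r)$ be the terminal object of the category $\mathbf{NAS}_\bullet$ of pointed non-anomalous semigroups, and give $\mathbb{R}$ the field structure with its given order and addition and with multiplicative identity a chosen element $1\in\mathbb{R}$, $1>0$. Up to a unique isomorphism, $\mathbb{R}$ is the unique complete ordered field: $\mathbb{R}$ is a complete ordered field, and for every complete ordered field $F$ there is a unique isomorphism of ordered fields between $F$ and $\mathbb{R}$.
   Context: Here $\mathbb{R}$ is defined only as the totally ordered semigroup (written additively) underlying the terminal object of $\mathbf{NAS}_\bullet$ (which exists and is unique up to isomorphism), not by a classical construction. It is a totally ordered abelian group. For each chosen $1\in\mathbb{R}$ with $1>0$ there is a unique product on $\mathbb{R}$ with identity $1$ making it an ordered ring (associative, distributive, products of positive elements positive), and with this product $\mathbb{R}$ is a field; this is the field structure meant. A totally ordered semigroup is a set $S$ with a binary relation $<$ and an operation $+$ (not assumed commutative) such that for all $x,y,z\in S$: (1) $x<y$ and $y<z$ imply $x<z$; (2) exactly one of $x<y$, $x=y$, $x>y$ holds; (3) $(x+y)+z=x+(y+z)$; (4) $x<y$ implies $x+z<y+z$ and $z+x<z+y$. $\mathbb{N}=\{1,2,3,\dots\}$ and $nx$ is the $n$-fold sum. Elements $x>y$ form an anomalous pair if either $nx<(n+1)y$ for every $n\in\mathbb{N}$, or $ny>(n+1)x$ for every $n\in\mathbb{N}$. A non-anomalous semigroup is a totally ordered semigroup with no anomalous pair. A positive (resp. negative) morphism is a map $f$ with $f(x+y)=f(x)+f(y)$ and $x<y\Rightarrow f(x)<f(y)$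 (resp. $x<y\Rightarrow f(x)>f(y)$); a morphism is a positive or negative morphism. $\mathbf{NAS}_\bullet$ has as objects pairs $(A,a)$ with $A$ a non-anomalous semigroup and $a\in A$ not an identity; arrows $(A,a)\to(B,b)$ are morphisms $f:A\to B$ with $f(a)=b$. An ordered field is a field with a total order compatible with addition such that $a,b>0$ implies $ab>0$. It is complete if every nonempty subset that is bounded above has a least upper bound. *)

theory Defs
  imports "HOL-Algebra.QuotRing" "HOL-Library.FuncSet" Complex_Main
begin

locale strict_total_order_on =
  fixes C :: "'a set" and lt :: "'a \<Rightarrow> 'a \<Rightarrow> bool"
  assumes lt_trans: "\<lbrakk>x \<in> C; y \<in> C; z \<in> C; lt x y; lt y z\<rbrakk> \<Longrightarrow> lt x z"
    and lt_trichotomy: "\<lbrakk>x \<in> C; y \<in> C\<rbrakk> \<Longrightarrow>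
      (lt x y \<and> x \<noteq> y \<and> \<not> lt y x) \<or> (\<not> lt x y \<and> x = y \<and> \<not> lt y x)
        \<or> (\<not> lt x y \<and> x \<noteq> y \<and> lt y x)"


section \<open>Non-anomalous semigroups\<close>

record 'a osg = "'a partial_object" +
  splus :: "'a \<Rightarrow> 'a \<Rightarrow> 'a" (infixl "\<boxplus>\<index>" 65)
  sless :: "'a \<Rightarrow> 'a \<Rightarrow> bool" (infix "\<prec>\<index>" 50)

locale totally_ordered_semigroup =
  strict_total_order_on "carrier S" "sless S" for S (structure) +
  assumes plus_closed: "\<lbrakk>x \<in> carrier S; y \<in> carrier S\<rbrakk> \<Longrightarrow> x \<boxplus> y \<in> carrier S"
    and plus_assoc: "\<lbrakk>x \<in> carrier S; y \<in> carrier S; z \<in> carrier S\<rbrakk>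
      \<Longrightarrow> (x \<boxplus> y) \<boxplus> z = x \<boxplus> (y \<boxplus> z)"
    and plus_strict_mono: "\<lbrakk>x \<in> carrier S; y \<in> carrier S; z \<in> carrier S; x \<prec> y\<rbrakk>
      \<Longrightarrow> x \<boxplus> z \<prec> y \<boxplus> z \<and> z \<boxplus> x \<prec> z \<boxplus> y"

text \<open>The \<open>n\<close>-fold sum of \<open>x\<close>, meaningful only for \<open>n \<ge> 1\<close>, since a semigroup need not have
  an empty sum.\<close>
definition nsum :: "('a, 'm) osg_scheme \<Rightarrow> nat \<Rightarrow> 'a \<Rightarrow> 'a" where
  "nsum S n x = ((\<lambda>y. y \<boxplus>\<^bsub>S\<^esub> x) ^^ (n - 1)) x"

definition anomalous_pair :: "('a, 'm) osg_scheme \<Rightarrow> 'a \<Rightarrow> 'a \<Rightarrow> bool" where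
  "anomalous_pair S x y \<longleftrightarrow>
     x \<in> carrier S \<and> y \<in> carrier S \<and> y \<prec>\<^bsub>S\<^esub> x \<and>
     ((\<forall>n\<ge>1. nsum S n x \<prec>\<^bsub>S\<^esub> nsum S (n + 1) y) \<or>
      (\<forall>n\<ge>1. nsum S (n + 1) x \<prec>\<^bsub>S\<^esub> nsum S n y))"

definition non_anomalous_semigroup :: "('a, 'm) osg_scheme \<Rightarrow> bool" where
  "non_anomalous_semigroup S \<longleftrightarrow>
     totally_ordered_semigroup S \<and> (\<forall>x y. \<not> anomalous_pair S x y)"

definition is_identity :: "('a, 'm) osg_scheme \<Rightarrow> 'a \<Rightarrow> bool" where
  "is_identity S e \<longleftrightarrow>
     e \<in> carrier S \<and> (\<forall>x\<in>carrier S. e \<boxplus>\<^bsub>S\<^esub> x = x \<and> x \<boxplus>\<^bsub>S\<^esub> e = x)"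

definition positive_morphism ::
  "('a, 'm) osg_scheme \<Rightarrow> ('b, 'n) osg_scheme \<Rightarrow> ('a \<Rightarrow> 'b) \<Rightarrow> bool" where
  "positive_morphism A B f \<longleftrightarrow>
     f \<in> carrier A \<rightarrow> carrier B \<and>
     (\<forall>x\<in>carrier A. \<forall>y\<in>carrier A. f (x \<boxplus>\<^bsub>A\<^esub> y) = f x \<boxplus>\<^bsub>B\<^esub> f y) \<and>
     (\<forall>x\<in>carrier A. \<forall>y\<in>carrier A. x \<prec>\<^bsub>A\<^esub> y \<longrightarrow> f x \<prec>\<^bsub>B\<^esub> f y)"

definition negative_morphism ::
  "('a, 'm) osg_scheme \<Rightarrow> ('b, 'n) osg_scheme \<Rightarrow> ('a \<Rightarrow> 'b) \<Rightarrow> bool" where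
  "negative_morphism A B f \<longleftrightarrow>
     f \<in> carrier A \<rightarrow> carrier B \<and>
     (\<forall>x\<in>carrier A. \<forall>y\<in>carrier A. f (x \<boxplus>\<^bsub>A\<^esub> y) = f x \<boxplus>\<^bsub>B\<^esub> f y) \<and>
     (\<forall>x\<in>carrier A. \<forall>y\<in>carrier A. x \<prec>\<^bsub>A\<^esub> y \<longrightarrow> f y \<prec>\<^bsub>B\<^esub> f x)"

definition nas_object :: "('a, 'm) osg_scheme \<Rightarrow> 'a \<Rightarrow> bool" where
  "nas_object A a \<longleftrightarrow> non_anomalous_semigroup A \<and> a \<in> carrier A \<and> \<not> is_identity A a"

text \<open>Arrows are taken extensional, so that equality of HOL functions is equality of maps on
  the carrier.\<close>
definition nas_arrows ::
  "('a, 'm) osg_scheme \<Rightarrow> 'a \<Rightarrow> ('b, 'n) osg_scheme \<Rightarrow> 'b \<Rightarrow> ('a \<Rightarrow> 'b) set" where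
  "nas_arrows A a B b =
     {f \<in> extensional (carrier A). (positive_morphism A B f \<or> negative_morphism A B f) \<and> f a = b}"

text \<open>HOL cannot quantify over all types inside a formula, so the test objects \<open>A\<close> range over the
  pointed non-anomalous semigroups whose carrier is a subset of the type carrying \<open>R\<close> itself.
  Terminality among all pointed non-anomalous semigroups implies this, so a theorem assuming
  \<open>nas_terminal R r\<close> covers the unrestricted notion.\<close>
definition nas_terminal :: "'a osg \<Rightarrow> 'a \<Rightarrow> bool" where
  "nas_terminal R r \<longleftrightarrow>
     nas_object R r \<and>
     (\<forall>(A :: 'a osg) a. nas_object A a \<longrightarrow> (\<exists>!f. f \<in> nas_arrows A a R r))"


section \<open>Ordered rings and fields\<close>

record 'a oring = "'a ring" +
  rless :: "'a \<Rightarrow> 'a \<Rightarrow> bool" (infix "\<lless>\<index>" 50)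

locale ord_ring = ring F + strict_total_order_on "carrier F" "rless F" for F (structure) +
  assumes add_strict_mono: "\<lbrakk>x \<in> carrier F; y \<in> carrier F; z \<in> carrier F; x \<lless> y\<rbrakk>
      \<Longrightarrow> x \<oplus> z \<lless> y \<oplus> z"
    and mult_pos: "\<lbrakk>x \<in> carrier F; y \<in> carrier F; \<zero> \<lless> x; \<zero> \<lless> y\<rbrakk> \<Longrightarrow> \<zero> \<lless> x \<otimes> y"

locale ord_field = ord_ring F + field F for F (structure)

definition upper_bound :: "('a, 'm) oring_scheme \<Rightarrow> 'a set \<Rightarrow> 'a \<Rightarrow> bool" where
  "upper_bound F X u \<longleftrightarrow> u \<in> carrier F \<and> (\<forall>x\<in>X. x \<lless>\<^bsub>F\<^esub> u \<or> x = u)"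

definition least_upper_bound :: "('a, 'm) oring_scheme \<Rightarrow> 'a set \<Rightarrow> 'a \<Rightarrow> bool" where
  "least_upper_bound F X s \<longleftrightarrow>
     upper_bound F X s \<and> (\<forall>u. upper_bound F X u \<longrightarrow> s \<lless>\<^bsub>F\<^esub> u \<or> s = u)"

locale complete_ord_field = ord_field F for F (structure) +
  assumes complete: "\<lbrakk>X \<subseteq> carrier F; X \<noteq> {}; \<exists>u. upper_bound F X u\<rbrakk>
      \<Longrightarrow> \<exists>s. least_upper_bound F X s"

definition ord_field_isos ::
  "('a, 'm) oring_scheme \<Rightarrow> ('b, 'n) oring_scheme \<Rightarrow> ('a \<Rightarrow> 'b) set" where
  "ord_field_isos F G =
     {f \<in> extensional (carrier F). f \<in> ring_iso F G \<and>
        (\<forall>x\<in>carrier F. \<forall>y\<in>carrier F. x \<lless>\<^bsub>F\<^esub> y \<longleftrightarrow> f x \<lless>\<^bsub>G\<^esub> f y)}"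


section \<open>The field structure on the terminal object\<close>

definition szero :: "('a, 'm) osg_scheme \<Rightarrow> 'a" where
  "szero S = (THE e. is_identity S e)"

definition oring_of :: "('a, 'm) osg_scheme \<Rightarrow> 'a \<Rightarrow> ('a \<Rightarrow> 'a \<Rightarrow> 'a) \<Rightarrow> 'a oring" where
  "oring_of S e m =
     \<lparr>carrier = carrier S, mult = m, one = e, zero = szero S, add = splus S, rless = sless S\<rparr>"

text \<open>The product is determined only on the carrier; outside it is normalised by extensionality
  so that the definite description can be unique.\<close>
definition the_product :: "('a, 'm) osg_scheme \<Rightarrow> 'a \<Rightarrow> 'a \<Rightarrow> 'a \<Rightarrow> 'a" where
  "the_product S e =
     (THE m. m \<in> carrier S \<rightarrow>\<^sub>E (carrier S \<rightarrow>\<^sub>E carrier S) \<and> ord_ring (oring_of S e m))"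

definition real_field :: "('a, 'm) osg_scheme \<Rightarrow> 'a \<Rightarrow> 'a oring" where
  "real_field S e = oring_of S e (the_product S e)"

end

theory Submission
  imports Defs "HOL-Library.Countable_Set"
begin

text \<open>
  Everything is compared with the real numbers of the library, through strictly monotone additive
  maps into them. Three facts carry the proof.

  Existence (Hoelder, Alimov): a non-anomalous semigroup with an element that is not an identity has
  a strictly monotone additive map to the reals that does not vanish at this element
  (\<open>hoelder_embedding\<close>). Absence of anomalous pairs forces the semigroup to be commutative and
  Archimedean; after that, an element is measured by a Dedekind cut, in units of a fixed positive
  element.

  Rigidity: such a map is determined by a single nonzero value (\<open>real_morphism_rigid\<close>), because the
  rational numbers are dense. It follows that such a map on an ordered ring, if it sends 1 to 1, is
  multiplicative (\<open>real_morphism_mult\<close>), and that there is at most one isomorphism between two ordered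
  fields isomorphic to the reals (\<open>coordinates_unique_iso\<close>).

  Surjectivity: the map is onto in the two cases at hand. For the terminal object \<open>R\<close>, a real number
  \<open>s\<close> together with the value at the base point generates a countable subsemigroup of the reals; by
  terminality it maps to \<open>R\<close>, and rigidity identifies the image of \<open>s\<close> as a preimage of \<open>s\<close>
  (\<open>terminal_real_morphism_surj\<close>). For a complete ordered field, completeness makes the additive
  semigroup non-anomalous, so that the map exists, and suprema provide the preimages
  (\<open>ex_real_coordinates\<close>).

  Hence both \<open>R\<close> and every complete ordered field are copies of the real line. The product on \<open>R\<close>
  is the product of the reals, by rigidity once more (\<open>real_field_coordinates\<close>), and the claim
  reduces to properties of the reals.
\<close>


section \<open>Ordered semigroups\<close>

lemma nsum_one [simp]: "nsum S (Suc 0) x = x"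
  by (simp add: nsum_def)

lemma nsum_Suc: "n \<ge> 1 \<Longrightarrow> nsum S (Suc n) x = nsum S n x \<boxplus>\<^bsub>S\<^esub> x"
  by (cases n) (simp_all add: nsum_def)

context strict_total_order_on
begin

lemma lt_irrefl: "x \<in> C \<Longrightarrow> \<not> lt x x"
  using lt_trichotomy by blast

lemma lt_asym: "\<lbrakk>x \<in> C; y \<in> C; lt x y\<rbrakk> \<Longrightarrow> \<not> lt y x"
  using lt_trichotomy by blast

lemma lt_linear: "\<lbrakk>x \<in> C; y \<in> C\<rbrakk> \<Longrightarrow> lt x y \<or> x = y \<or> lt y x"
  using lt_trichotomy by blast

end

context totally_ordered_semigroup
begin

lemma nsum_closed [simp]: "x \<in> carrier S \<Longrightarrow> nsum S n x \<in> carrier S"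
proof (induction n)
  case 0 then show ?case by (simp add: nsum_def)
next
  case (Suc n) then show ?case
    by (cases "n \<ge> 1") (simp_all add: nsum_Suc plus_closed not_less_eq_eq)
qed

lemma plus_less_mono:
  assumes "a \<in> carrier S" "b \<in> carrier S" "c \<in> carrier S" "d \<in> carrier S" "a \<prec> b" "c \<prec> d"
  shows "a \<boxplus> c \<prec> b \<boxplus> d"
proof (rule lt_trans)
  show "a \<boxplus> c \<prec> b \<boxplus> c" using assms plus_strict_mono by blast
  show "b \<boxplus> c \<prec> b \<boxplus> d" using assms plus_strict_mono by blast
qed (use assms in \<open>auto intro: plus_closed\<close>)

lemma plus_less_cancel_right:
  assumes "a \<in> carrier S" "b \<in> carrier S" "c \<in> carrier S"
  shows "a \<boxplus> c \<prec> b \<boxplus> c \<longleftrightarrow> a \<prec> b"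
  by (metis assms lt_irrefl lt_asym lt_linear plus_closed plus_strict_mono)

lemma plus_less_cancel_left:
  assumes "a \<in> carrier S" "b \<in> carrier S" "c \<in> carrier S"
  shows "c \<boxplus> a \<prec> c \<boxplus> b \<longleftrightarrow> a \<prec> b"
  by (metis assms lt_irrefl lt_asym lt_linear plus_closed plus_strict_mono)

lemma plus_cancel_right:
  assumes "a \<in> carrier S" "b \<in> carrier S" "c \<in> carrier S" "a \<boxplus> c = b \<boxplus> c"
  shows "a = b"
  by (metis assms lt_irrefl lt_linear plus_closed plus_strict_mono)

lemma plus_cancel_left:
  assumes "a \<in> carrier S" "b \<in> carrier S" "c \<in> carrier S" "c \<boxplus> a = c \<boxplus> b"
  shows "a = b"
  by (metis assms lt_irrefl lt_linear plus_closed plus_strict_mono)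

lemma nsum_add:
  assumes "x \<in> carrier S" "m \<ge> 1" "n \<ge> 1"
  shows "nsum S (m + n) x = nsum S m x \<boxplus> nsum S n x"
  using assms(3)
proof (induction n rule: dec_induct)
  case base then show ?case using assms by (simp add: nsum_Suc)
next
  case (step n) then show ?case using assms by (simp add: nsum_Suc plus_assoc)
qed

lemma nsum_Suc': "x \<in> carrier S \<Longrightarrow> n \<ge> 1 \<Longrightarrow> nsum S (Suc n) x = x \<boxplus> nsum S n x"
  using nsum_add[of x 1 n] by simp

lemma nsum_strict_mono:
  assumes "x \<in> carrier S" "y \<in> carrier S" "x \<prec> y" "n \<ge> 1"
  shows "nsum S n x \<prec> nsum S n y"
  using assms(4)
proof (induction n rule: dec_induct)
  case base then show ?case using assms by simp
next
  case (step n) then show ?case using assms by (simp add: nsum_Suc plus_less_mono)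
qed

lemma nsum_mult:
  assumes "x \<in> carrier S" "m \<ge> 1" "n \<ge> 1"
  shows "nsum S n (nsum S m x) = nsum S (n * m) x"
  using assms(3)
proof (induction n rule: dec_induct)
  case base then show ?case by simp
next
  case (step n)
  then have "nsum S (Suc n) (nsum S m x) = nsum S (n * m) x \<boxplus> nsum S m x"
    by (simp add: nsum_Suc)
  also have "\<dots> = nsum S (n * m + m) x"
    using step assms by (simp add: nsum_add)
  finally show ?case by (simp add: add.commute)
qed

text \<open>The sign of an element can be read off from its double alone, because the order is
  cancellative: if adding \<open>x\<close> enlarges \<open>x\<close>, then it enlarges everything.\<close>

lemma positive_left:
  assumes "x \<in> carrier S" "z \<in> carrier S" "x \<prec> x \<boxplus> x"
  shows "z \<prec> x \<boxplus> z"
  by (metis assms plus_assoc plus_closed plus_less_cancel_left plus_less_cancel_right)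

lemma positive_right:
  assumes "x \<in> carrier S" "z \<in> carrier S" "x \<prec> x \<boxplus> x"
  shows "z \<prec> z \<boxplus> x"
  by (metis assms plus_assoc plus_closed plus_less_cancel_left plus_less_cancel_right)

lemma negative_left:
  assumes "x \<in> carrier S" "z \<in> carrier S" "x \<boxplus> x \<prec> x"
  shows "x \<boxplus> z \<prec> z"
  by (metis assms plus_assoc plus_closed plus_less_cancel_left plus_less_cancel_right)

lemma negative_right:
  assumes "x \<in> carrier S" "z \<in> carrier S" "x \<boxplus> x \<prec> x"
  shows "z \<boxplus> x \<prec> z"
  by (metis assms plus_assoc plus_closed plus_less_cancel_left plus_less_cancel_right)

lemma idempotent_is_identity:
  assumes "x \<in> carrier S" "x \<boxplus> x = x"
  shows "is_identity S x"
  unfolding is_identity_def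
  by (metis assms plus_assoc plus_closed plus_cancel_left plus_cancel_right)

lemma sign_cases:
  assumes "x \<in> carrier S"
  obtains (pos) "x \<prec> x \<boxplus> x" | (neg) "x \<boxplus> x \<prec> x" | (zero) "is_identity S x"
  using assms idempotent_is_identity lt_linear plus_closed by metis

lemma nsum_less_Suc:
  assumes "p \<in> carrier S" "p \<prec> p \<boxplus> p" "1 \<le> n"
  shows "nsum S n p \<prec> nsum S (Suc n) p"
  using assms by (simp add: nsum_Suc positive_right)

lemma nsum_index_strict_mono:
  assumes "p \<in> carrier S" "p \<prec> p \<boxplus> p" "1 \<le> m" "m < n"
  shows "nsum S m p \<prec> nsum S n p"
  using Suc_leI[OF assms(4)]
proof (induction n rule: dec_induct)
  case base then show ?case using assms nsum_less_Suc by simp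
next
  case (step n)
  have "nsum S n p \<prec> nsum S (Suc n) p" using assms step by (intro nsum_less_Suc) auto
  with step show ?case using assms lt_trans nsum_closed by blast
qed

lemma nsum_index_less_iff:
  assumes "p \<in> carrier S" "p \<prec> p \<boxplus> p" "1 \<le> m" "1 \<le> n"
  shows "nsum S m p \<prec> nsum S n p \<longleftrightarrow> m < n"
  by (metis assms lt_asym lt_irrefl nsum_closed nsum_index_strict_mono linorder_neqE_nat)

text \<open>Shifting the brackets turns \<open>a + b + a + b + \<dots> + a + b\<close> into a sum of copies of \<open>b + a\<close>
  with one \<open>a\<close> left over in front and one \<open>b\<close> at the end. Hence the multiples of the two sums
  interlace, which makes them candidates for an anomalous pair if they differ.\<close>

lemma nsum_Suc_swap:
  assumes "a \<in> carrier S" "b \<in> carrier S" "n \<ge> 1"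
  shows "nsum S (Suc n) (a \<boxplus> b) = a \<boxplus> (nsum S n (b \<boxplus> a) \<boxplus> b)"
  using assms(3)
proof (induction n rule: dec_induct)
  case base then show ?case using assms by (simp add: nsum_Suc plus_assoc plus_closed)
next
  case (step n)
  have "nsum S (Suc (Suc n)) (a \<boxplus> b) = a \<boxplus> (nsum S n (b \<boxplus> a) \<boxplus> b) \<boxplus> (a \<boxplus> b)"
    using step nsum_Suc[of "Suc n" S "a \<boxplus> b"] by simp
  also have "\<dots> = a \<boxplus> (nsum S (Suc n) (b \<boxplus> a) \<boxplus> b)"
    using assms step by (simp add: nsum_Suc[of n] plus_assoc plus_closed)
  finally show ?case .
qed

end


section \<open>Non-anomalous semigroups are commutative and Archimedean\<close>

locale nas_semigroup = totally_ordered_semigroup S for S (structure) +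
  assumes not_anomalous: "\<not> anomalous_pair S x y"

lemma nas_semigroup_iff: "nas_semigroup S \<longleftrightarrow> non_anomalous_semigroup S"
  by (auto simp: nas_semigroup_def nas_semigroup_axioms_def non_anomalous_semigroup_def)

context nas_semigroup
begin

lemma not_anomalous_pos:
  assumes "x \<in> carrier S" "y \<in> carrier S" "y \<prec> x"
  obtains n where "n \<ge> 1" "\<not> nsum S n x \<prec> nsum S (Suc n) y"
  using not_anomalous[of x y] assms unfolding anomalous_pair_def by fastforce

lemma not_anomalous_neg:
  assumes "x \<in> carrier S" "y \<in> carrier S" "y \<prec> x"
  obtains n where "n \<ge> 1" "\<not> nsum S (Suc n) x \<prec> nsum S n y"
  using not_anomalous[of x y] assms unfolding anomalous_pair_def by fastforce

text \<open>If \<open>a + b < b + a\<close>, then \<open>n(b + a)\<close> lies inside \<open>(n + 1)(a + b) = a + n(b + a) + b\<close>, and it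
  is smaller because \<open>a\<close> and \<open>b\<close> are positive. So \<open>b + a\<close> and \<open>a + b\<close> form an anomalous pair. For
  negative elements the same decomposition gives the other kind of anomalous pair.\<close>

lemma positive_not_less_swap:
  assumes "a \<in> carrier S" "b \<in> carrier S" "a \<prec> a \<boxplus> a" "b \<prec> b \<boxplus> b"
  shows "\<not> a \<boxplus> b \<prec> b \<boxplus> a"
proof
  assume less: "a \<boxplus> b \<prec> b \<boxplus> a"
  then obtain n where n: "n \<ge> 1" "\<not> nsum S n (b \<boxplus> a) \<prec> nsum S (Suc n) (a \<boxplus> b)"
    using assms not_anomalous_pos plus_closed by metis
  let ?c = "nsum S n (b \<boxplus> a)"
  have c: "?c \<in> carrier S" using assms by (simp add: plus_closed)
  have "?c \<prec> ?c \<boxplus> b" using assms c positive_right by blast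
  moreover have "?c \<boxplus> b \<prec> a \<boxplus> (?c \<boxplus> b)" using assms c positive_left plus_closed by blast
  ultimately have "?c \<prec> a \<boxplus> (?c \<boxplus> b)" using lt_trans c assms plus_closed by meson
  then show False using n nsum_Suc_swap[of a b n] assms by simp
qed

lemma negative_not_less_swap:
  assumes "a \<in> carrier S" "b \<in> carrier S" "a \<boxplus> a \<prec> a" "b \<boxplus> b \<prec> b"
  shows "\<not> a \<boxplus> b \<prec> b \<boxplus> a"
proof
  assume less: "a \<boxplus> b \<prec> b \<boxplus> a"
  then obtain n where n: "n \<ge> 1" "\<not> nsum S (Suc n) (b \<boxplus> a) \<prec> nsum S n (a \<boxplus> b)"
    using assms not_anomalous_neg plus_closed by metis
  let ?c = "nsum S n (a \<boxplus> b)"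
  have c: "?c \<in> carrier S" using assms by (simp add: plus_closed)
  have "?c \<boxplus> a \<prec> ?c" using assms c negative_right by blast
  moreover have "b \<boxplus> (?c \<boxplus> a) \<prec> ?c \<boxplus> a" using assms c negative_left plus_closed by blast
  ultimately have "b \<boxplus> (?c \<boxplus> a) \<prec> ?c" using lt_trans c assms plus_closed by meson
  then show False using n nsum_Suc_swap[of b a n] assms by simp
qed

lemma positive_commute:
  assumes "a \<in> carrier S" "b \<in> carrier S" "a \<prec> a \<boxplus> a" "b \<prec> b \<boxplus> b"
  shows "a \<boxplus> b = b \<boxplus> a"
  using positive_not_less_swap assms lt_linear plus_closed by metis

lemma negative_commute:
  assumes "a \<in> carrier S" "b \<in> carrier S" "a \<boxplus> a \<prec> a" "b \<boxplus> b \<prec> b"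
  shows "a \<boxplus> b = b \<boxplus> a"
  using negative_not_less_swap assms lt_linear plus_closed by metis

text \<open>The sum \<open>a + b\<close> has the sign of one of its summands or is an identity. In the first two cases it
  commutes with that summand by the results above, and cancelling the summand gives the claim. In the
  last case \<open>(b + a) + b = b + (a + b) = (a + b) + b\<close>, and \<open>b\<close> cancels.\<close>

lemma opposite_signs_commute:
  assumes a: "a \<in> carrier S" and b: "b \<in> carrier S" and "a \<prec> a \<boxplus> a" "b \<boxplus> b \<prec> b"
  shows "a \<boxplus> b = b \<boxplus> a"
proof -
  have c: "a \<boxplus> b \<in> carrier S" "b \<boxplus> a \<in> carrier S" using a b plus_closed by auto
  from c(1) show ?thesis
  proof (cases rule: sign_cases)
    case pos
    then have "a \<boxplus> (a \<boxplus> b) = (a \<boxplus> b) \<boxplus> a" using positive_commute a c assms by blast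
    then have "a \<boxplus> (a \<boxplus> b) = a \<boxplus> (b \<boxplus> a)" using a b plus_assoc by simp
    then show ?thesis using plus_cancel_left a c by blast
  next
    case neg
    then have "(a \<boxplus> b) \<boxplus> b = b \<boxplus> (a \<boxplus> b)" using negative_commute b c assms by blast
    then have "(a \<boxplus> b) \<boxplus> b = (b \<boxplus> a) \<boxplus> b" using a b plus_assoc by simp
    then show ?thesis using plus_cancel_right b c by blast
  next
    case zero
    then have "(b \<boxplus> a) \<boxplus> b = (a \<boxplus> b) \<boxplus> b" using a b plus_assoc by (simp add: is_identity_def)
    then show ?thesis using plus_cancel_right[of "b \<boxplus> a" "a \<boxplus> b" b] b c by simp
  qed
qed

lemma plus_commute:
  assumes a: "a \<in> carrier S" and b: "b \<in> carrier S"
  shows "a \<boxplus> b = b \<boxplus> a"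
  using a
proof (cases rule: sign_cases)
  case pos
  from b show ?thesis
    by (cases rule: sign_cases)
      (use a pos positive_commute b opposite_signs_commute in \<open>auto simp: is_identity_def\<close>)
next
  case neg
  from b show ?thesis
    by (cases rule: sign_cases)
      (use a neg negative_commute b opposite_signs_commute[of b a] in \<open>auto simp: is_identity_def\<close>)
next
  case zero
  with b show ?thesis by (auto simp: is_identity_def)
qed

lemma plus_left_commute:
  assumes "a \<in> carrier S" "b \<in> carrier S" "c \<in> carrier S"
  shows "a \<boxplus> (b \<boxplus> c) = b \<boxplus> (a \<boxplus> c)"
  by (metis assms plus_assoc plus_commute)

lemma nsum_plus_distrib:
  assumes "x \<in> carrier S" "y \<in> carrier S" "n \<ge> 1"
  shows "nsum S n (x \<boxplus> y) = nsum S n x \<boxplus> nsum S n y"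
  using assms(3)
proof (induction n rule: dec_induct)
  case base then show ?case by simp
next
  case (step n) then show ?case
    using assms by (simp add: nsum_Suc plus_closed plus_assoc plus_commute plus_left_commute)
qed

text \<open>If every multiple of \<open>p\<close> stayed below \<open>x\<close>, then \<open>n(x + p) = nx + np < (n + 1)x\<close> for all
  \<open>n\<close>, and \<open>x + p\<close> and \<open>x\<close> would form an anomalous pair.\<close>

lemma archimedean_above:
  assumes p: "p \<in> carrier S" "p \<prec> p \<boxplus> p" and x: "x \<in> carrier S"
  obtains m where "m \<ge> 1" "x \<prec> nsum S m p"
proof (rule ccontr)
  assume "\<not> thesis"
  with that have small: "\<not> x \<prec> nsum S m p" if "m \<ge> 1" for m using that by blast
  have below: "nsum S m p \<prec> x" if "m \<ge> 1" for m
    using small[of "Suc m"] nsum_less_Suc[OF p that] that lt_linear[of x "nsum S (Suc m) p"]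
      lt_trans[of "nsum S m p" "nsum S (Suc m) p" x] p x by auto
  obtain n where n: "n \<ge> 1" "\<not> nsum S n (x \<boxplus> p) \<prec> nsum S (Suc n) x"
    using not_anomalous_pos[of "x \<boxplus> p" x] positive_right[OF p(1) x p(2)] p x plus_closed by metis
  have "nsum S n x \<boxplus> nsum S n p \<prec> nsum S n x \<boxplus> x"
    using below[OF n(1)] plus_less_cancel_left p x by simp
  then show False using n p x by (simp add: nsum_plus_distrib nsum_Suc)
qed

text \<open>The counterpart for an element that may be very negative. If no multiple of \<open>p\<close> lifts \<open>x\<close> above
  \<open>p\<close>, then all \<open>x + kp\<close> are negative, hence
  \<open>(n + 1)(x + p) = (x + (n + 1)p) + nx < nx\<close>, and again \<open>x + p\<close> and \<open>x\<close> form an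
  anomalous pair.\<close>

lemma archimedean_below:
  assumes p: "p \<in> carrier S" "p \<prec> p \<boxplus> p" and x: "x \<in> carrier S"
  obtains k where "k \<ge> 1" "p \<prec> x \<boxplus> nsum S k p"
proof (rule ccontr)
  assume "\<not> thesis"
  with that have small: "\<not> p \<prec> x \<boxplus> nsum S k p" if "k \<ge> 1" for k using that by blast
  have neg: "x \<boxplus> nsum S k p \<boxplus> z \<prec> z" if k: "k \<ge> 1" and z: "z \<in> carrier S" for k z
  proof -
    have *: "x \<boxplus> nsum S k p \<in> carrier S" "x \<boxplus> nsum S (Suc k) p \<in> carrier S"
      using p x plus_closed by auto
    have "\<not> p \<prec> x \<boxplus> nsum S (Suc k) p" "\<not> p \<prec> x \<boxplus> nsum S (Suc (Suc k)) p" using small by auto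
    moreover have "x \<boxplus> nsum S (Suc k) p \<prec> x \<boxplus> nsum S (Suc (Suc k)) p"
      using nsum_less_Suc[OF p, of "Suc k"] plus_less_cancel_left p x by simp
    ultimately have "x \<boxplus> nsum S (Suc k) p \<prec> p"
      using * p(1) x lt_linear[of p "x \<boxplus> nsum S (Suc k) p"] by auto
    then have "(x \<boxplus> nsum S k p) \<boxplus> p \<prec> p" using k p x by (simp add: nsum_Suc plus_assoc)
    then have "((x \<boxplus> nsum S k p) \<boxplus> z) \<boxplus> p \<prec> z \<boxplus> p"
      using plus_less_cancel_left[of "(x \<boxplus> nsum S k p) \<boxplus> p" p z] * p z x
      by (simp add: plus_assoc plus_commute plus_left_commute plus_closed)
    then show ?thesis using plus_less_cancel_right * p z plus_closed by blast
  qed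
  obtain n where n: "n \<ge> 1" "\<not> nsum S (Suc n) (x \<boxplus> p) \<prec> nsum S n x"
    using not_anomalous_neg[of "x \<boxplus> p" x] positive_right[OF p(1) x p(2)] p x plus_closed by metis
  have "(x \<boxplus> nsum S (Suc n) p) \<boxplus> nsum S n x \<prec> nsum S n x" using neg x by simp
  moreover have "nsum S (Suc n) (x \<boxplus> p) = (x \<boxplus> nsum S (Suc n) p) \<boxplus> nsum S n x"
    using n p x nsum_Suc'[of x n]
    by (simp add: nsum_plus_distrib plus_assoc plus_commute plus_left_commute)
  ultimately show False using n by simp
qed

end


section \<open>Hoelder's embedding into the reals\<close>

definition real_osg :: "real osg" where
  "real_osg = \<lparr>carrier = UNIV, splus = (+), sless = (<)\<rparr>"

lemma real_osg_simps [simp]: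
  "carrier real_osg = UNIV" "x \<boxplus>\<^bsub>real_osg\<^esub> y = x + y" "x \<prec>\<^bsub>real_osg\<^esub> y \<longleftrightarrow> x < y"
  by (simp_all add: real_osg_def)

lemma positive_morphism_real_osg:
  "positive_morphism S real_osg \<phi> \<longleftrightarrow>
    (\<forall>x\<in>carrier S. \<forall>y\<in>carrier S. \<phi> (x \<boxplus>\<^bsub>S\<^esub> y) = \<phi> x + \<phi> y) \<and>
    (\<forall>x\<in>carrier S. \<forall>y\<in>carrier S. x \<prec>\<^bsub>S\<^esub> y \<longrightarrow> \<phi> x < \<phi> y)"
  by (simp add: positive_morphism_def)

text \<open>This is how all estimates below become exact: errors are controlled only up to a constant, but for
  all multiples at once.\<close>

lemma bounded_multiples_imp_nonpos:
  fixes a b :: real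
  assumes "\<And>n::nat. n \<ge> 1 \<Longrightarrow> real n * a \<le> b"
  shows "a \<le> 0"
proof (rule ccontr)
  assume "\<not> a \<le> 0"
  then obtain n where "b < real n * a" using reals_Archimedean3[of a] by auto
  moreover have "real n * a \<le> real (Suc n) * a" using \<open>\<not> a \<le> 0\<close> by (simp add: algebra_simps)
  ultimately show False using assms[of "Suc n"] by simp
qed

text \<open>The element \<open>p\<close> serves as unit of measurement. A semigroup has no differences, so the rational
  number \<open>(m - k)/n\<close> is compared with \<open>x\<close> by comparing \<open>mp\<close> with \<open>nx + kp\<close>. Both \<open>m\<close> and \<open>k\<close>
  are kept positive, as there is no empty sum.\<close>

locale nas_unit = nas_semigroup S for S (structure) +
  fixes p
  assumes p_closed [simp]: "p \<in> carrier S" and p_positive: "p \<prec> p \<boxplus> p"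
begin

definition cuts :: "'a \<Rightarrow> real set" where
  "cuts x = {(real m - real k) / real n | m k n.
     m \<ge> 1 \<and> k \<ge> 1 \<and> n \<ge> 1 \<and> nsum S m p \<prec> nsum S n x \<boxplus> nsum S k p}"

definition magnitude :: "'a \<Rightarrow> real" where
  "magnitude x = Sup (cuts x)"

text \<open>The Dedekind cut of \<open>x\<close> is consistent: fractions found to be below \<open>x\<close> are smaller than those
  found to be above. Bring both comparisons to the multiple \<open>nn'x\<close>, add them crosswise and cancel
  \<open>nn'x\<close>; what remains compares two multiples of the positive element \<open>p\<close>.\<close>

lemma cross_multiply:
  assumes x: "x \<in> carrier S"
    and pos: "m \<ge> 1" "k \<ge> 1" "n \<ge> 1" "m' \<ge> 1" "k' \<ge> 1" "n' \<ge> 1"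
    and lower: "nsum S m p \<prec> nsum S n x \<boxplus> nsum S k p"
    and upper: "nsum S n' x \<boxplus> nsum S k' p \<prec> nsum S m' p"
  shows "(real m - real k) / real n < (real m' - real k') / real n'"
proof -
  have npos: "n * m' \<ge> 1" "n' * m \<ge> 1" "n * k' \<ge> 1" "n' * k \<ge> 1" "n * n' \<ge> 1"
    using pos by (simp_all add: Suc_le_eq)
  have "nsum S n' (nsum S m p) \<prec> nsum S n' (nsum S n x \<boxplus> nsum S k p)"
    using lower pos x by (intro nsum_strict_mono) (auto simp: plus_closed)
  then have 1: "nsum S (n' * m) p \<prec> nsum S (n * n') x \<boxplus> nsum S (n' * k) p"
    using pos x by (simp add: nsum_mult nsum_plus_distrib mult.commute)
  have "nsum S n (nsum S n' x \<boxplus> nsum S k' p) \<prec> nsum S n (nsum S m' p)"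
    using upper pos x by (intro nsum_strict_mono) (auto simp: plus_closed)
  then have 2: "nsum S (n * n') x \<boxplus> nsum S (n * k') p \<prec> nsum S (n * m') p"
    using pos x by (simp add: nsum_mult nsum_plus_distrib)
  have "nsum S (n' * m) p \<boxplus> (nsum S (n * n') x \<boxplus> nsum S (n * k') p)
      \<prec> (nsum S (n * n') x \<boxplus> nsum S (n' * k) p) \<boxplus> nsum S (n * m') p"
    using 1 2 x by (intro plus_less_mono) (auto simp: plus_closed)
  then have "nsum S (n * n') x \<boxplus> (nsum S (n' * m) p \<boxplus> nsum S (n * k') p)
      \<prec> nsum S (n * n') x \<boxplus> (nsum S (n' * k) p \<boxplus> nsum S (n * m') p)"
    using x by (simp add: plus_assoc plus_left_commute plus_closed)
  then have "nsum S (n' * m) p \<boxplus> nsum S (n * k') p \<prec> nsum S (n' * k) p \<boxplus> nsum S (n * m') p"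
    using x by (simp add: plus_less_cancel_left plus_closed)
  then have "nsum S (n' * m + n * k') p \<prec> nsum S (n' * k + n * m') p"
    using npos by (simp add: nsum_add)
  then have "n' * m + n * k' < n' * k + n * m'"
    using nsum_index_less_iff[OF p_closed p_positive] npos by auto
  then have "real (n' * m + n * k') < real (n' * k + n * m')" by (simp only: of_nat_less_iff)
  then show ?thesis using pos by (simp add: field_simps)
qed

lemma ex_lower:
  assumes "x \<in> carrier S"
  obtains k where "k \<ge> 1" "nsum S 1 p \<prec> x \<boxplus> nsum S k p"
  using archimedean_below[OF p_closed p_positive assms] by (metis One_nat_def nsum_one)

lemma ex_upper:
  assumes "x \<in> carrier S"
  obtains m where "m \<ge> 1" "x \<boxplus> nsum S k p \<prec> nsum S m p"
  using archimedean_above[OF p_closed p_positive plus_closed[OF assms nsum_closed[OF p_closed]]]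
  by blast

lemma cuts_nonempty: "x \<in> carrier S \<Longrightarrow> cuts x \<noteq> {}"
proof -
  assume "x \<in> carrier S"
  then obtain k where "k \<ge> 1" "nsum S 1 p \<prec> x \<boxplus> nsum S k p" by (rule ex_lower)
  then have "(real 1 - real k) / real 1 \<in> cuts x" unfolding cuts_def
    by (intro CollectI exI[of _ 1] exI[of _ k]) auto
  then show ?thesis by blast
qed

lemma magnitude_upper_bound:
  assumes "x \<in> carrier S" "m \<ge> 1" "k \<ge> 1" "n \<ge> 1" "nsum S n x \<boxplus> nsum S k p \<prec> nsum S m p"
  shows "real n * magnitude x \<le> real m - real k"
proof -
  have "magnitude x \<le> (real m - real k) / real n"
    unfolding magnitude_def
  proof (rule cSup_least[OF cuts_nonempty[OF assms(1)]])
    fix c assume "c \<in> cuts x"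
    then show "c \<le> (real m - real k) / real n"
      unfolding cuts_def using cross_multiply assms by (blast intro: less_imp_le)
  qed
  then show ?thesis using assms by (simp add: field_simps)
qed

lemma cuts_bdd_above: "x \<in> carrier S \<Longrightarrow> bdd_above (cuts x)"
proof -
  assume x: "x \<in> carrier S"
  obtain m where m: "m \<ge> 1" "x \<boxplus> nsum S 1 p \<prec> nsum S m p" using ex_upper x by blast
  have "c \<le> (real m - real 1) / real 1" if "c \<in> cuts x" for c
    using that cross_multiply[of x _ _ _ m 1 1] x m unfolding cuts_def
    by (simp only: nsum_one One_nat_def) (blast intro: less_imp_le)
  then show ?thesis by (rule bdd_aboveI)
qed

lemma magnitude_lower_bound:
  assumes "x \<in> carrier S" "m \<ge> 1" "k \<ge> 1" "n \<ge> 1" "nsum S m p \<prec> nsum S n x \<boxplus> nsum S k p"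
  shows "real m - real k \<le> real n * magnitude x"
proof -
  have "(real m - real k) / real n \<le> magnitude x"
    unfolding magnitude_def
    by (rule cSup_upper[OF _ cuts_bdd_above[OF assms(1)]]) (use assms in \<open>unfold cuts_def, blast\<close>)
  then show ?thesis using assms by (simp add: field_simps)
qed

text \<open>An integer part of \<open>x\<close>: some integer \<open>m - k\<close> satisfies \<open>m - k < x < m - k + 2\<close> in units of \<open>p\<close>.
  The width is 2 rather than 1, so that both inequalities can be strict. The summand \<open>kp\<close> first lifts
  \<open>x\<close> above \<open>p\<close>; then \<open>mp\<close> is the largest multiple of \<open>p\<close> that stays below.\<close>

lemma ex_bracket:
  assumes x: "x \<in> carrier S"
  obtains m k where "m \<ge> 1" "k \<ge> 1" "nsum S m p \<prec> x \<boxplus> nsum S k p"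
    "x \<boxplus> nsum S k p \<prec> nsum S (m + 2) p"
proof -
  obtain k where k: "k \<ge> 1" "nsum S 1 p \<prec> x \<boxplus> nsum S k p" using ex_lower x by blast
  let ?y = "x \<boxplus> nsum S k p"
  have y: "?y \<in> carrier S" using x by (simp add: plus_closed)
  obtain u where u: "u \<ge> 1" "?y \<prec> nsum S u p" using ex_upper x by blast
  define L where "L = {m. m \<ge> 1 \<and> nsum S m p \<prec> ?y}"
  have L: "L \<subseteq> {..u}"
  proof
    fix m assume "m \<in> L"
    then have "m \<ge> 1" "nsum S m p \<prec> nsum S u p"
      using u(2) lt_trans[of "nsum S m p" ?y "nsum S u p"] y by (auto simp: L_def)
    then show "m \<in> {..u}" using nsum_index_less_iff[OF p_closed p_positive] u(1) by auto
  qed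
  then have fin: "finite L" using finite_subset by blast
  have "1 \<in> L" using k by (simp add: L_def)
  define m where "m = Max L"
  have "m \<in> L" unfolding m_def using fin \<open>1 \<in> L\<close> by (intro Max_in) auto
  have "Suc m \<notin> L" using Max_ge[OF fin, of "Suc m"] by (auto simp: m_def)
  then have "\<not> nsum S (Suc m) p \<prec> ?y" by (simp add: L_def)
  then have "?y \<prec> nsum S (m + 2) p"
    using nsum_less_Suc[OF p_closed p_positive, of "Suc m"]
      lt_linear[of ?y "nsum S (Suc m) p"] lt_trans[of ?y "nsum S (Suc m) p" "nsum S (m + 2) p"] y
    by auto
  then show ?thesis using that[of m k] \<open>m \<in> L\<close> k(1) by (simp add: L_def)
qed

text \<open>Monotonicity and additivity both come from the integer parts of \<open>nx\<close>: these determine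
  \<open>n \<cdot> magnitude x\<close> up to a bounded error, for every \<open>n\<close>.\<close>

lemma magnitude_mono:
  assumes x: "x \<in> carrier S" and y: "y \<in> carrier S" and less: "x \<prec> y"
  shows "magnitude x \<le> magnitude y"
proof -
  have "real n * (magnitude x - magnitude y) \<le> 2" if n: "n \<ge> 1" for n :: nat
  proof -
    obtain m k where mk: "m \<ge> 1" "k \<ge> 1" "nsum S m p \<prec> nsum S n x \<boxplus> nsum S k p"
      "nsum S n x \<boxplus> nsum S k p \<prec> nsum S (m + 2) p" using ex_bracket x nsum_closed by blast
    have "nsum S n x \<boxplus> nsum S k p \<prec> nsum S n y \<boxplus> nsum S k p"
      using nsum_strict_mono[OF x y less n] x y by (simp add: plus_less_cancel_right)
    then have "nsum S m p \<prec> nsum S n y \<boxplus> nsum S k p"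
      using mk(3) lt_trans x y plus_closed nsum_closed p_closed by meson
    then have "real m - real k \<le> real n * magnitude y" using magnitude_lower_bound y mk n by blast
    moreover have "real n * magnitude x \<le> real (m + 2) - real k"
      using magnitude_upper_bound[of x "m+2" k n] x mk n by simp
    ultimately show ?thesis by (simp add: algebra_simps)
  qed
  then show ?thesis using bounded_multiples_imp_nonpos[of "magnitude x - magnitude y" 2] by simp
qed

lemma magnitude_plus:
  assumes x: "x \<in> carrier S" and y: "y \<in> carrier S"
  shows "magnitude (x \<boxplus> y) = magnitude x + magnitude y"
proof -
  have *: "real n * (magnitude (x \<boxplus> y) - (magnitude x + magnitude y)) \<le> 4 \<and>
      real n * (magnitude x + magnitude y - magnitude (x \<boxplus> y)) \<le> 4" if n: "n \<ge> 1" for n :: nat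
  proof -
    obtain m k where mk: "m \<ge> 1" "k \<ge> 1" "nsum S m p \<prec> nsum S n x \<boxplus> nsum S k p"
      "nsum S n x \<boxplus> nsum S k p \<prec> nsum S (m + 2) p" using ex_bracket x nsum_closed by blast
    obtain m' k' where mk': "m' \<ge> 1" "k' \<ge> 1" "nsum S m' p \<prec> nsum S n y \<boxplus> nsum S k' p"
      "nsum S n y \<boxplus> nsum S k' p \<prec> nsum S (m' + 2) p" using ex_bracket y nsum_closed by blast
    have sum: "nsum S n (x \<boxplus> y) \<boxplus> nsum S (k + k') p =
        (nsum S n x \<boxplus> nsum S k p) \<boxplus> (nsum S n y \<boxplus> nsum S k' p)"
      using x y n mk mk'
      by (simp add: nsum_plus_distrib nsum_add plus_assoc plus_left_commute plus_closed)
    have "nsum S m p \<boxplus> nsum S m' p \<prec> nsum S n (x \<boxplus> y) \<boxplus> nsum S (k + k') p"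
      unfolding sum using mk mk' x y by (intro plus_less_mono) (auto simp: plus_closed)
    then have "nsum S (m + m') p \<prec> nsum S n (x \<boxplus> y) \<boxplus> nsum S (k + k') p"
      using mk mk' by (simp add: nsum_add)
    then have 1: "real (m + m') - real (k + k') \<le> real n * magnitude (x \<boxplus> y)"
      using magnitude_lower_bound[of "x \<boxplus> y" "m + m'" "k + k'" n] mk mk' n x y plus_closed by simp
    have "nsum S n (x \<boxplus> y) \<boxplus> nsum S (k + k') p \<prec> nsum S (m + 2) p \<boxplus> nsum S (m' + 2) p"
      unfolding sum using mk mk' x y by (intro plus_less_mono) (auto simp: plus_closed)
    then have "nsum S n (x \<boxplus> y) \<boxplus> nsum S (k + k') p \<prec> nsum S ((m + 2) + (m' + 2)) p"
      by (subst nsum_add) auto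
    then have 2: "real n * magnitude (x \<boxplus> y) \<le> real ((m + 2) + (m' + 2)) - real (k + k')"
      using magnitude_upper_bound[of "x \<boxplus> y" "(m + 2) + (m' + 2)" "k + k'" n] mk mk' n x y plus_closed
      by simp
    have "real m - real k \<le> real n * magnitude x" "real n * magnitude x \<le> real (m + 2) - real k"
      using magnitude_lower_bound[of x m k n] magnitude_upper_bound[of x "m+2" k n] x mk n by auto
    moreover have "real m' - real k' \<le> real n * magnitude y" "real n * magnitude y \<le> real (m' + 2) - real k'"
      using magnitude_lower_bound[of y m' k' n] magnitude_upper_bound[of y "m'+2" k' n] y mk' n by auto
    ultimately show ?thesis using 1 2 by (simp add: algebra_simps)
  qed
  have "magnitude (x \<boxplus> y) - (magnitude x + magnitude y) \<le> 0" "magnitude x + magnitude y - magnitude (x \<boxplus> y) \<le> 0"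
    using * by (blast intro: bounded_multiples_imp_nonpos)+
  then show ?thesis by simp
qed

lemma magnitude_nsum:
  assumes "x \<in> carrier S" "n \<ge> 1"
  shows "magnitude (nsum S n x) = real n * magnitude x"
  using assms(2)
proof (induction n rule: dec_induct)
  case base then show ?case by simp
next
  case (step n) then show ?case using assms by (simp add: nsum_Suc magnitude_plus algebra_simps)
qed

lemma magnitude_unit: "magnitude p = 1"
proof -
  have "real n * (magnitude p - 1) \<le> 1 \<and> real n * (1 - magnitude p) \<le> 1" if n: "n \<ge> 1" for n
  proof -
    have eq: "nsum S n p \<boxplus> nsum S 1 p = nsum S (Suc n) p"
      "nsum S n p \<boxplus> nsum S 1 p = nsum S (n + 1) p"
      using n by (simp_all add: nsum_Suc)
    have "nsum S n p \<boxplus> nsum S 1 p \<prec> nsum S (n + 2) p"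
      using eq nsum_less_Suc[OF p_closed p_positive, of "Suc n"] by simp
    then have "real n * magnitude p \<le> real (n + 2) - real 1" using n by (intro magnitude_upper_bound) auto
    moreover have "nsum S n p \<prec> nsum S n p \<boxplus> nsum S 1 p"
      using eq nsum_less_Suc[OF p_closed p_positive n] by simp
    then have "real n - real 1 \<le> real n * magnitude p" using n by (intro magnitude_lower_bound) auto
    ultimately show ?thesis by (simp add: algebra_simps)
  qed
  then have "magnitude p - 1 \<le> 0" "1 - magnitude p \<le> 0" by (blast intro: bounded_multiples_imp_nonpos)+
  then show ?thesis by simp
qed

text \<open>The two halves of non-anomaly give \<open>(n + 1)x \<le> ny\<close> for some \<open>n\<close> and \<open>nx \<le> (n + 1)y\<close>
  for some \<open>n\<close>. If \<open>x\<close> and \<open>y\<close> have the same magnitude \<open>c\<close>, the first says \<open>c \<le> 0\<close> and the second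
  \<open>c \<ge> 0\<close>.\<close>

lemma magnitude_eq_imp_zero:
  assumes x: "x \<in> carrier S" and y: "y \<in> carrier S" and less: "x \<prec> y" and eq: "magnitude x = magnitude y"
  shows "magnitude x = 0"
proof -
  have mono: "magnitude b \<le> magnitude a" if "a \<in> carrier S" "b \<in> carrier S" "\<not> a \<prec> b" for a b
    using that lt_linear magnitude_mono by auto
  obtain n where n: "n \<ge> 1" "\<not> nsum S n y \<prec> nsum S (Suc n) x" using not_anomalous_pos x y less by metis
  have "real (Suc n) * magnitude x \<le> real n * magnitude y"
    using mono[OF _ _ n(2)] n(1) x y magnitude_nsum[of x "Suc n"] magnitude_nsum[of y n] by simp
  moreover obtain n' where n': "n' \<ge> 1" "\<not> nsum S (Suc n') y \<prec> nsum S n' x"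
    using not_anomalous_neg x y less by metis
  have "real n' * magnitude x \<le> real (Suc n') * magnitude y"
    using mono[OF _ _ n'(2)] n'(1) x y magnitude_nsum[of x n'] magnitude_nsum[of y "Suc n'"] by simp
  ultimately show ?thesis using eq by (simp add: algebra_simps)
qed

text \<open>A common magnitude of \<open>x < y\<close> would have to be 0, but so would that of \<open>x + p < y + p\<close>, which is
  larger by 1.\<close>

lemma magnitude_strict_mono:
  assumes x: "x \<in> carrier S" and y: "y \<in> carrier S" and less: "x \<prec> y"
  shows "magnitude x < magnitude y"
proof (rule ccontr)
  assume "\<not> magnitude x < magnitude y"
  then have eq: "magnitude x = magnitude y" using magnitude_mono[OF x y less] by simp
  have "magnitude (x \<boxplus> p) = 0"
    using eq x y less plus_strict_mono[of x y p]
    by (intro magnitude_eq_imp_zero[of _ "y \<boxplus> p"]) (auto simp: plus_closed magnitude_plus)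
  then show False using magnitude_eq_imp_zero[OF x y less eq] x by (simp add: magnitude_plus magnitude_unit)
qed

lemma magnitude_morphism: "positive_morphism S real_osg magnitude"
  by (simp add: positive_morphism_real_osg magnitude_plus magnitude_strict_mono)

end

lemma hoelder_positive:
  assumes "non_anomalous_semigroup S" "a \<in> carrier S" "a \<prec>\<^bsub>S\<^esub> a \<boxplus>\<^bsub>S\<^esub> a"
  obtains \<phi> where "positive_morphism S real_osg \<phi>" "\<phi> a = 1"
proof -
  interpret nas_unit S a
    using assms by (simp add: nas_unit_def nas_unit_axioms_def nas_semigroup_iff)
  show ?thesis using that magnitude_morphism magnitude_unit by blast
qed

definition dual_osg :: "('a, 'm) osg_scheme \<Rightarrow> 'a osg" where
  "dual_osg S = \<lparr>carrier = carrier S, splus = splus S, sless = (\<lambda>x y. y \<prec>\<^bsub>S\<^esub> x)\<rparr>"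

lemma dual_osg_simps [simp]:
  "carrier (dual_osg S) = carrier S" "splus (dual_osg S) = splus S"
  "x \<prec>\<^bsub>dual_osg S\<^esub> y \<longleftrightarrow> y \<prec>\<^bsub>S\<^esub> x"
  by (simp_all add: dual_osg_def)

lemma nsum_dual_osg [simp]: "nsum (dual_osg S) n x = nsum S n x"
  by (simp add: nsum_def)

lemma non_anomalous_dual_osg:
  assumes "non_anomalous_semigroup S"
  shows "non_anomalous_semigroup (dual_osg S)"
proof -
  interpret nas_semigroup S using assms by (simp add: nas_semigroup_iff)
  have "totally_ordered_semigroup (dual_osg S)"
  proof
    fix x y z
    assume "x \<in> carrier (dual_osg S)" "y \<in> carrier (dual_osg S)" "z \<in> carrier (dual_osg S)"
      "x \<prec>\<^bsub>dual_osg S\<^esub> y" "y \<prec>\<^bsub>dual_osg S\<^esub> z"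
    then show "x \<prec>\<^bsub>dual_osg S\<^esub> z" using lt_trans[of z y x] by simp
  next
    fix x y assume "x \<in> carrier (dual_osg S)" "y \<in> carrier (dual_osg S)"
    then show "(x \<prec>\<^bsub>dual_osg S\<^esub> y \<and> x \<noteq> y \<and> \<not> y \<prec>\<^bsub>dual_osg S\<^esub> x) \<or>
        (\<not> x \<prec>\<^bsub>dual_osg S\<^esub> y \<and> x = y \<and> \<not> y \<prec>\<^bsub>dual_osg S\<^esub> x) \<or>
        (\<not> x \<prec>\<^bsub>dual_osg S\<^esub> y \<and> x \<noteq> y \<and> y \<prec>\<^bsub>dual_osg S\<^esub> x)"
      using lt_trichotomy[of x y] by auto
  qed (auto simp: plus_closed plus_assoc plus_strict_mono)
  moreover have "\<not> anomalous_pair (dual_osg S) x y" for x y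
    using not_anomalous[of y x] by (auto simp: anomalous_pair_def)
  ultimately show ?thesis by (simp add: non_anomalous_semigroup_def)
qed

text \<open>A negative element becomes positive when the order is reversed, and reversal keeps the absence of
  anomalous pairs: it exchanges the members of a pair and the two kinds of pairs. Negating the map for
  the reversed order restores monotonicity.\<close>

theorem hoelder_embedding:
  assumes "nas_object S a"
  obtains \<phi> where "positive_morphism S real_osg \<phi>" "\<phi> a \<noteq> 0"
proof -
  have nas: "non_anomalous_semigroup S" and a: "a \<in> carrier S" "\<not> is_identity S a"
    using assms by (auto simp: nas_object_def)
  interpret nas_semigroup S using nas by (simp add: nas_semigroup_iff)
  from a(1) show ?thesis
  proof (cases rule: sign_cases)
    case pos
    obtain \<phi> where "positive_morphism S real_osg \<phi>" "\<phi> a = 1"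
      using hoelder_positive[OF nas a(1) pos] by blast
    then show ?thesis using that by simp
  next
    case neg
    then have "a \<prec>\<^bsub>dual_osg S\<^esub> a \<boxplus>\<^bsub>dual_osg S\<^esub> a" by simp
    then obtain \<phi> where \<phi>: "positive_morphism (dual_osg S) real_osg \<phi>" "\<phi> a = 1"
      using hoelder_positive[OF non_anomalous_dual_osg[OF nas], of a] a(1) by auto
    have "positive_morphism S real_osg (\<lambda>x. - \<phi> x)"
      using \<phi>(1) by (simp add: positive_morphism_real_osg)
    then show ?thesis using that \<phi>(2) by simp
  next
    case zero
    then show ?thesis using a(2) by blast
  qed
qed


section \<open>Rigidity of real-valued morphisms\<close>

lemma (in totally_ordered_semigroup) real_morphism_less_iff:
  assumes "positive_morphism S real_osg \<phi>" "x \<in> carrier S" "y \<in> carrier S"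
  shows "\<phi> x < \<phi> y \<longleftrightarrow> x \<prec> y"
  using assms lt_linear[of x y]
  unfolding positive_morphism_real_osg by (metis less_asym less_irrefl)

lemma (in totally_ordered_semigroup) real_morphism_inj:
  assumes "positive_morphism S real_osg \<phi>"
  shows "inj_on \<phi> (carrier S)"
  using lt_linear real_morphism_less_iff[OF assms] by (metis inj_onI less_irrefl)

lemma (in totally_ordered_semigroup) real_morphism_nsum:
  assumes \<phi>: "\<And>x y. \<lbrakk>x \<in> carrier S; y \<in> carrier S\<rbrakk> \<Longrightarrow> \<phi> (x \<boxplus> y) = \<phi> x + (\<phi> y :: real)"
    and x: "x \<in> carrier S" and "n \<ge> 1"
  shows "\<phi> (nsum S n x) = real n * \<phi> x"
  using assms(3)
proof (induction n rule: dec_induct)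
  case base then show ?case by simp
next
  case (step n) then show ?case using \<phi> x by (simp add: nsum_Suc algebra_simps)
qed

text \<open>A rational number between \<open>a/c\<close> and \<open>b/c\<close>, cleared of denominators and written as a difference of
  positive naturals, so that it can be tested in a semigroup without zero or inverses.\<close>

lemma ex_fraction_between:
  fixes a b c :: real
  assumes "a < b" "c \<noteq> 0"
  obtains m k n :: nat where "m \<ge> 1" "k \<ge> 1" "n \<ge> 1"
    "real n * a + real k * c < real m * c" "real m * c < real n * b + real k * c"
proof -
  have "\<exists>q\<in>\<rat>. a < q * c \<and> q * c < b"
  proof (cases "c > 0")
    case True
    then have "a / c < b / c" using assms by (simp add: divide_strict_right_mono)
    then obtain q where "q \<in> \<rat>" "a / c < q" "q < b / c" using Rats_dense_in_real by blast
    then show ?thesis using True by (auto simp: field_simps)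
  next
    case False
    then have "c < 0" using assms by simp
    then have "b / c < a / c" using assms by (simp add: divide_strict_right_mono_neg)
    then obtain q where "q \<in> \<rat>" "b / c < q" "q < a / c" using Rats_dense_in_real by blast
    then show ?thesis using \<open>c < 0\<close> by (auto simp: field_simps)
  qed
  then obtain q where q: "q \<in> \<rat>" "a < q * c" "q * c < b" by blast
  from q(1) obtain i j :: int where ij: "j > 0" "q = of_int i / of_int j" by (rule Rats_cases')
  define n where "n = nat j"
  define k where "k = nat (\<bar>i\<bar> + 1)"
  define m where "m = nat (i + int k)"
  have pos: "n \<ge> 1" "k \<ge> 1" "m \<ge> 1" using ij by (auto simp: n_def k_def m_def)
  have "real m - real k = of_int i" "real n = of_int j" using ij by (auto simp: n_def k_def m_def)
  then have "real n * q = real m - real k" using ij by simp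
  then have eq: "real n * (q * c) = real m * c - real k * c" by (metis left_diff_distrib mult.assoc)
  have "real n * a < real n * (q * c)" "real n * (q * c) < real n * b" using q pos by simp_all
  then show ?thesis using that[OF pos(3,2,1)] eq by simp
qed

text \<open>If \<open>\<phi> x < \<psi> x\<close>, a rational multiple of the common value at \<open>p\<close> lies strictly in between. The
  corresponding sums \<open>nx + kp\<close> and \<open>mp\<close> would then be ordered in one way according to \<open>\<phi>\<close> and in
  the other way according to \<open>\<psi>\<close>.\<close>

lemma (in totally_ordered_semigroup) real_morphism_rigid:
  assumes \<phi>: "positive_morphism S real_osg \<phi>" and \<psi>: "positive_morphism S real_osg \<psi>"
    and p: "p \<in> carrier S" "\<phi> p = \<psi> p" "\<phi> p \<noteq> 0" and x: "x \<in> carrier S"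
  shows "\<phi> x = \<psi> x"
proof -
  have not_less: "\<not> \<phi>' x < \<psi>' x"
    if \<phi>': "positive_morphism S real_osg \<phi>'" and \<psi>': "positive_morphism S real_osg \<psi>'"
      and eq: "\<phi>' p = \<psi>' p" "\<phi>' p \<noteq> 0" for \<phi>' \<psi>'
  proof
    assume "\<phi>' x < \<psi>' x"
    then obtain m k n :: nat where mkn: "m \<ge> 1" "k \<ge> 1" "n \<ge> 1"
      "real n * \<phi>' x + real k * \<phi>' p < real m * \<phi>' p"
      "real m * \<phi>' p < real n * \<psi>' x + real k * \<phi>' p"
      using ex_fraction_between eq(2) by metis
    define y z where "y = nsum S n x \<boxplus> nsum S k p" and "z = nsum S m p"
    have yz: "y \<in> carrier S" "z \<in> carrier S" using x p by (auto simp: y_def z_def plus_closed)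
    have val: "\<theta> y = real n * \<theta> x + real k * \<theta> p" "\<theta> z = real m * \<theta> p"
      if \<theta>: "positive_morphism S real_osg \<theta>" for \<theta>
      using \<theta> x p mkn by (auto simp: y_def z_def real_morphism_nsum positive_morphism_real_osg)
    have "y \<prec> z" using mkn(4) val[OF \<phi>'] real_morphism_less_iff[OF \<phi>' yz] by simp
    moreover have "z \<prec> y"
      using mkn(5) val[OF \<psi>'] real_morphism_less_iff[OF \<psi>' yz(2,1)] eq by simp
    ultimately show False using lt_asym yz by blast
  qed
  show ?thesis using not_less[OF \<phi> \<psi>] not_less[OF \<psi> \<phi>] p by simp
qed


section \<open>The terminal object is the whole real line\<close>

text \<open>An anomalous pair in a subsemigroup of the reals would be a pair of numbers whose difference has
  bounded multiples.\<close>

lemma non_anomalous_if_embedded: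
  assumes closed: "\<And>x y. \<lbrakk>x \<in> carrier A; y \<in> carrier A\<rbrakk> \<Longrightarrow> x \<boxplus>\<^bsub>A\<^esub> y \<in> carrier A"
    and plus: "\<And>x y. \<lbrakk>x \<in> carrier A; y \<in> carrier A\<rbrakk> \<Longrightarrow> \<iota> (x \<boxplus>\<^bsub>A\<^esub> y) = \<iota> x + (\<iota> y :: real)"
    and less: "\<And>x y. \<lbrakk>x \<in> carrier A; y \<in> carrier A\<rbrakk> \<Longrightarrow> x \<prec>\<^bsub>A\<^esub> y \<longleftrightarrow> \<iota> x < \<iota> y"
    and inj: "inj_on \<iota> (carrier A)"
  shows "non_anomalous_semigroup A"
proof -
  have eq_iff: "x = y \<longleftrightarrow> \<iota> x = \<iota> y" if "x \<in> carrier A" "y \<in> carrier A" for x y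
    using inj that by (auto dest: inj_onD)
  have tos: "totally_ordered_semigroup A"
    by unfold_locales (auto simp: closed plus less eq_iff)
  interpret totally_ordered_semigroup A by (fact tos)
  have "\<not> anomalous_pair A x y" for x y
  proof
    assume "anomalous_pair A x y"
    then have x: "x \<in> carrier A" and y: "y \<in> carrier A" and yx: "\<iota> y < \<iota> x"
      and "(\<forall>n\<ge>1. nsum A n x \<prec>\<^bsub>A\<^esub> nsum A (n + 1) y) \<or>
        (\<forall>n\<ge>1. nsum A (n + 1) x \<prec>\<^bsub>A\<^esub> nsum A n y)"
      by (auto simp: anomalous_pair_def less)
    moreover have "\<iota> (nsum A n x) = real n * \<iota> x" "\<iota> (nsum A n y) = real n * \<iota> y" if "n \<ge> 1" for n
      using real_morphism_nsum[OF plus] x y that by auto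
    ultimately have "(\<forall>n\<ge>1. real n * \<iota> x < real (n + 1) * \<iota> y) \<or>
        (\<forall>n\<ge>1. real (n + 1) * \<iota> x < real n * \<iota> y)"
      by (simp add: less)
    then have "\<iota> x - \<iota> y \<le> 0"
    proof
      assume *: "\<forall>n\<ge>1. real n * \<iota> x < real (n + 1) * \<iota> y"
      show ?thesis
      proof (rule bounded_multiples_imp_nonpos)
        fix n :: nat assume "n \<ge> 1"
        with * have "real n * \<iota> x < real (n + 1) * \<iota> y" by blast
        then show "real n * (\<iota> x - \<iota> y) \<le> \<iota> y" by (simp add: algebra_simps)
      qed
    next
      assume *: "\<forall>n\<ge>1. real (n + 1) * \<iota> x < real n * \<iota> y"
      show ?thesis
      proof (rule bounded_multiples_imp_nonpos)
        fix n :: nat assume "n \<ge> 1"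
        with * have "real (n + 1) * \<iota> x < real n * \<iota> y" by blast
        then show "real n * (\<iota> x - \<iota> y) \<le> - \<iota> x" by (simp add: algebra_simps)
      qed
    qed
    then show False using yx by simp
  qed
  then show ?thesis using tos by (simp add: non_anomalous_semigroup_def)
qed

text \<open>Given a real number \<open>s\<close>, the test object is the subsemigroup \<open>B\<close> of the reals generated by
  \<open>\<phi> r\<close> and \<open>s\<close>, with base point \<open>\<phi> r\<close>. Its arrow into \<open>R\<close>, followed by \<open>\<phi>\<close>, is an
  additive map from \<open>B\<close> to the reals that fixes \<open>\<phi> r\<close>; by rigidity it fixes \<open>s\<close>, so \<open>s\<close> is a
  value of \<open>\<phi>\<close>. The elements of a test object have to come from the type of \<open>R\<close>, whatever its
  cardinality. They can, because \<open>B\<close> is countable while the multiples of \<open>r\<close> are infinitely many elements of \<open>R\<close>.\<close>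

lemma terminal_real_morphism_surj:
  fixes R :: "'a osg"
  assumes R: "nas_terminal R r"
    and \<phi>: "positive_morphism R real_osg \<phi>" and c: "\<phi> r \<noteq> 0"
  shows "\<phi> ` carrier R = UNIV"
proof -
  have r: "r \<in> carrier R" and nas: "non_anomalous_semigroup R"
    using R by (auto simp: nas_terminal_def nas_object_def)
  have arrow: "\<exists>f. f \<in> nas_arrows A a R r" if "nas_object A a" for A :: "'a osg" and a
    using R that unfolding nas_terminal_def by blast
  interpret nas_semigroup R using nas by (simp add: nas_semigroup_iff)
  have \<phi>_plus: "\<And>x y. \<lbrakk>x \<in> carrier R; y \<in> carrier R\<rbrakk> \<Longrightarrow> \<phi> (x \<boxplus>\<^bsub>R\<^esub> y) = \<phi> x + \<phi> y"
    and \<phi>_less: "\<And>x y. \<lbrakk>x \<in> carrier R; y \<in> carrier R; x \<prec>\<^bsub>R\<^esub> y\<rbrakk> \<Longrightarrow> \<phi> x < \<phi> y"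
    using \<phi> by (auto simp: positive_morphism_real_osg)
  have "s \<in> \<phi> ` carrier R" for s
  proof -
    define B where "B = {real a * \<phi> r + real b * s | a b. a + b \<ge> (1::nat)}"
    have B_plus: "x + y \<in> B" if "x \<in> B" "y \<in> B" for x y
    proof -
      from that obtain a b a' b' where "a + b \<ge> 1" "x = real a * \<phi> r + real b * s"
        "a' + b' \<ge> 1" "y = real a' * \<phi> r + real b' * s"
        by (auto simp: B_def)
      then have "x + y = real (a + a') * \<phi> r + real (b + b') * s" "(a + a') + (b + b') \<ge> 1"
        by (auto simp: algebra_simps)
      then show ?thesis unfolding B_def by blast
    qed
    have "\<phi> r = real 1 * \<phi> r + real 0 * s" "s = real 0 * \<phi> r + real 1 * s" by simp_all
    then have B: "\<phi> r \<in> B" "s \<in> B" unfolding B_def by fastforce+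
    have "B \<subseteq> (\<lambda>(a, b). real a * \<phi> r + real b * s) ` UNIV" by (auto simp: B_def)
    then have "countable B" by (rule countable_subset) simp
    \<comment> \<open>A copy of \<open>B\<close> inside \<open>R\<close>: the element with number \<open>n\<close>, counted from 0, is
      represented by the \<open>(n + 1)\<close>-fold sum of \<open>r\<close>, since only positive multiples are meaningful.\<close>
    define h where "h x = nsum R (Suc (to_nat_on B x)) r" for x
    have \<phi>_h: "\<phi> (h x) = real (Suc (to_nat_on B x)) * \<phi> r" for x
      unfolding h_def by (rule real_morphism_nsum[OF \<phi>_plus r]) simp_all
    have inj_h: "inj_on h B"
    proof (rule inj_onI)
      fix x y assume xy: "x \<in> B" "y \<in> B" "h x = h y"
      then have "real (Suc (to_nat_on B x)) * \<phi> r = real (Suc (to_nat_on B y)) * \<phi> r"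
        using \<phi>_h by metis
      then have "to_nat_on B x = to_nat_on B y" using c by simp
      then show "x = y" using inj_on_to_nat_on[OF \<open>countable B\<close>] xy by (auto dest: inj_onD)
    qed
    define \<iota> where "\<iota> = inv_into B h"
    have \<iota>_h [simp]: "\<iota> (h x) = x" if "x \<in> B" for x using inj_h that by (simp add: \<iota>_def)
    define A :: "'a osg" where
      "A = \<lparr>carrier = h ` B, splus = (\<lambda>x y. h (\<iota> x + \<iota> y)), sless = (\<lambda>x y. \<iota> x < \<iota> y)\<rparr>"
    have A [simp]: "carrier A = h ` B" "\<And>x y. x \<boxplus>\<^bsub>A\<^esub> y = h (\<iota> x + \<iota> y)"
      "\<And>x y. x \<prec>\<^bsub>A\<^esub> y \<longleftrightarrow> \<iota> x < \<iota> y" by (simp_all add: A_def)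
    have nas_A: "non_anomalous_semigroup A"
      by (rule non_anomalous_if_embedded[of _ \<iota>]) (auto simp: B_plus intro!: inj_onI)
    then interpret A: totally_ordered_semigroup A by (simp add: non_anomalous_semigroup_def)
    have "\<not> is_identity A (h (\<phi> r))"
    proof
      assume "is_identity A (h (\<phi> r))"
      then have "h (\<phi> r) \<boxplus>\<^bsub>A\<^esub> h (\<phi> r) = h (\<phi> r)" using B unfolding is_identity_def A(1) by blast
      then have "h (\<phi> r + \<phi> r) = h (\<phi> r)" unfolding A(2) \<iota>_h[OF B(1)] .
      then have "\<phi> r + \<phi> r = \<phi> r" by (rule inj_onD[OF inj_h]) (intro B B_plus)+
      then show False using c by simp
    qed
    then have "nas_object A (h (\<phi> r))" using nas_A B by (simp add: nas_object_def)
    then obtain f where "f \<in> nas_arrows A (h (\<phi> r)) R r" using arrow by blast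
    then have f_r: "f (h (\<phi> r)) = r"
      and f: "positive_morphism A R f \<or> negative_morphism A R f"
      by (auto simp: nas_arrows_def)
    have f_closed: "f (h x) \<in> carrier R" if "x \<in> B" for x
      using f that by (auto simp: positive_morphism_def negative_morphism_def)
    have f_plus: "f (h (x + y)) = f (h x) \<boxplus>\<^bsub>R\<^esub> f (h y)" if "x \<in> B" "y \<in> B" for x y
      using f that by (auto simp: positive_morphism_def negative_morphism_def)
    \<comment> \<open>A negative arrow would reverse the order of \<open>\<phi> r\<close> and its double, both of which are fixed.\<close>
    have "\<not> negative_morphism A R f"
    proof
      assume neg: "negative_morphism A R f"
      have anti: "\<phi> (f (h y)) < \<phi> (f (h x))" if "x \<in> B" "y \<in> B" "x < y" for x y
        using that neg f_closed by (intro \<phi>_less) (auto simp: negative_morphism_def)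
      define d where "d = \<phi> r + \<phi> r"
      have d: "d \<in> B" unfolding d_def by (intro B B_plus)
      have fixed: "\<phi> (f (h d)) = d" "\<phi> (f (h (\<phi> r))) = \<phi> r"
        unfolding d_def f_plus[OF B(1) B(1)] f_r using \<phi>_plus r by blast+
      have "\<phi> r \<noteq> d" using c by (simp add: d_def)
      then show False using anti[OF B(1) d] anti[OF d B(1)] fixed by linarith
    qed
    then have pos: "positive_morphism A R f" using f by blast
    have "positive_morphism A real_osg (\<lambda>x. \<phi> (f x))"
      using pos f_closed f_plus \<phi>_plus \<phi>_less
      by (auto simp: positive_morphism_real_osg positive_morphism_def)
    moreover have "positive_morphism A real_osg \<iota>"
      using B_plus by (auto simp: positive_morphism_real_osg)
    ultimately have "\<phi> (f (h s)) = \<iota> (h s)"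
      using A.real_morphism_rigid[of "\<lambda>x. \<phi> (f x)" \<iota> "h (\<phi> r)" "h s"] B f_r c by simp
    then show ?thesis using B f_closed by (metis \<iota>_h image_eqI)
  qed
  then show ?thesis by blast
qed


section \<open>Ordered rings with real coordinates\<close>

definition additive_osg :: "('a, 'm) oring_scheme \<Rightarrow> 'a osg" where
  "additive_osg F = \<lparr>carrier = carrier F, splus = add F, sless = rless F\<rparr>"

lemma additive_osg_simps [simp]:
  "carrier (additive_osg F) = carrier F"
  "x \<boxplus>\<^bsub>additive_osg F\<^esub> y = x \<oplus>\<^bsub>F\<^esub> y"
  "x \<prec>\<^bsub>additive_osg F\<^esub> y \<longleftrightarrow> x \<lless>\<^bsub>F\<^esub> y"
  by (simp_all add: additive_osg_def)

context ord_ring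
begin

lemma add_strict_mono_left:
  "\<lbrakk>x \<in> carrier F; y \<in> carrier F; z \<in> carrier F; x \<lless> y\<rbrakk> \<Longrightarrow> z \<oplus> x \<lless> z \<oplus> y"
  using add_strict_mono by (simp add: a_comm)

lemma additive_semigroup: "totally_ordered_semigroup (additive_osg F)"
proof -
  have "strict_total_order_on (carrier F) (rless F)" by unfold_locales
  then show ?thesis
    by (auto simp: totally_ordered_semigroup_def totally_ordered_semigroup_axioms_def additive_osg_def
        a_assoc add_strict_mono add_strict_mono_left)
qed

lemma neg_iff_minus_pos:
  assumes "x \<in> carrier F"
  shows "x \<lless> \<zero> \<longleftrightarrow> \<zero> \<lless> \<ominus> x"
  using add_strict_mono[of x \<zero> "\<ominus> x"] add_strict_mono[of \<zero> "\<ominus> x" x] assms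
  by (auto simp: r_neg l_neg)

lemma mult_strict_mono_left:
  assumes "a \<in> carrier F" "x \<in> carrier F" "y \<in> carrier F" "\<zero> \<lless> a" "x \<lless> y"
  shows "a \<otimes> x \<lless> a \<otimes> y"
proof -
  have "\<zero> \<lless> y \<oplus> \<ominus> x" using add_strict_mono[of x y "\<ominus> x"] assms by (simp add: r_neg)
  then have "\<zero> \<lless> a \<otimes> (y \<oplus> \<ominus> x)" using mult_pos assms by simp
  then have "\<zero> \<oplus> a \<otimes> x \<lless> a \<otimes> (y \<oplus> \<ominus> x) \<oplus> a \<otimes> x"
    using assms by (intro add_strict_mono) auto
  moreover have "a \<otimes> (y \<oplus> \<ominus> x) \<oplus> a \<otimes> x = a \<otimes> y"
    using assms by (simp add: r_distr [symmetric] a_assoc l_neg)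
  ultimately show ?thesis using assms by simp
qed

lemma real_morphism_zero:
  assumes "positive_morphism (additive_osg F) real_osg \<psi>"
  shows "\<psi> \<zero> = 0"
proof -
  have "\<psi> (\<zero> \<oplus> \<zero>) = \<psi> \<zero> + \<psi> \<zero>"
    using assms by (simp add: positive_morphism_real_osg del: r_zero l_zero)
  then show ?thesis by simp
qed

lemma real_morphism_minus:
  assumes "positive_morphism (additive_osg F) real_osg \<psi>" "x \<in> carrier F"
  shows "\<psi> (\<ominus> x) = - \<psi> x"
proof -
  have "\<psi> (\<ominus> x \<oplus> x) = \<psi> (\<ominus> x) + \<psi> x"
    using assms by (simp add: positive_morphism_real_osg del: l_neg)
  then show ?thesis using real_morphism_zero[OF assms(1)] assms by (simp add: l_neg)
qed

text \<open>For \<open>a > 0\<close>, the map \<open>x \<mapsto> \<psi>(ax)/\<psi>(a)\<close> is additive, strictly monotone and agrees with \<open>\<psi>\<close>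
  at 1, so it is \<open>\<psi>\<close> by rigidity. Thus addition and order alone force \<open>\<psi>\<close> to be multiplicative;
  the same fact gives the uniqueness of the product on the terminal object.\<close>

lemma real_morphism_mult:
  assumes \<psi>: "positive_morphism (additive_osg F) real_osg \<psi>" and one: "\<psi> \<one> = 1"
    and a: "a \<in> carrier F" and x: "x \<in> carrier F"
  shows "\<psi> (a \<otimes> x) = \<psi> a * \<psi> x"
proof -
  interpret add: totally_ordered_semigroup "additive_osg F" by (rule additive_semigroup)
  have pos: "\<psi> (b \<otimes> x) = \<psi> b * \<psi> x" if b: "b \<in> carrier F" "\<zero> \<lless> b" for b
  proof -
    have "\<psi> \<zero> < \<psi> b" using \<psi> b by (simp add: positive_morphism_real_osg)
    then have b_pos: "\<psi> b > 0" using real_morphism_zero[OF \<psi>] by simp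
    have "positive_morphism (additive_osg F) real_osg (\<lambda>y. \<psi> (b \<otimes> y) / \<psi> b)"
      using \<psi> b b_pos
      by (auto simp: positive_morphism_real_osg r_distr add_divide_distrib mult_strict_mono_left
          divide_strict_right_mono)
    then have "\<psi> (b \<otimes> x) / \<psi> b = \<psi> x"
      by (rule add.real_morphism_rigid[OF _ \<psi>, where p = \<one>]) (use b_pos b x one in auto)
    then show ?thesis using b_pos by (simp add: field_simps)
  qed
  consider "\<zero> \<lless> a" | "a = \<zero>" | "a \<lless> \<zero>" using lt_linear a by blast
  then show ?thesis
  proof cases
    case 1 then show ?thesis using pos a by blast
  next
    case 2 then show ?thesis using x real_morphism_zero[OF \<psi>] by simp
  next
    case 3
    then have "\<psi> (\<ominus> a \<otimes> x) = \<psi> (\<ominus> a) * \<psi> x" using pos a neg_iff_minus_pos by simp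
    then show ?thesis using a x real_morphism_minus[OF \<psi>] by (simp add: l_minus)
  qed
qed

end

text \<open>An isomorphism onto the real numbers, formulated so that the field axioms of \<open>F\<close> are read off
  from the coordinates; the terminal object acquires its field structure in this way.\<close>

locale real_coordinates =
  fixes F (structure) and \<psi> :: "'a \<Rightarrow> real"
  assumes bij: "bij_betw \<psi> (carrier F) UNIV"
    and add_closed: "\<lbrakk>x \<in> carrier F; y \<in> carrier F\<rbrakk> \<Longrightarrow> x \<oplus> y \<in> carrier F"
    and mult_closed: "\<lbrakk>x \<in> carrier F; y \<in> carrier F\<rbrakk> \<Longrightarrow> x \<otimes> y \<in> carrier F"
    and zero_in: "\<zero> \<in> carrier F" and one_in: "\<one> \<in> carrier F"
    and coord_add: "\<lbrakk>x \<in> carrier F; y \<in> carrier F\<rbrakk> \<Longrightarrow> \<psi> (x \<oplus> y) = \<psi> x + \<psi> y"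
    and coord_mult: "\<lbrakk>x \<in> carrier F; y \<in> carrier F\<rbrakk> \<Longrightarrow> \<psi> (x \<otimes> y) = \<psi> x * \<psi> y"
    and coord_zero: "\<psi> \<zero> = 0" and coord_one: "\<psi> \<one> = 1"
    and coord_less: "\<lbrakk>x \<in> carrier F; y \<in> carrier F\<rbrakk> \<Longrightarrow> x \<lless> y \<longleftrightarrow> \<psi> x < \<psi> y"
begin

lemma coord_eq_iff: "\<lbrakk>x \<in> carrier F; y \<in> carrier F\<rbrakk> \<Longrightarrow> x = y \<longleftrightarrow> \<psi> x = \<psi> y"
  using bij by (auto simp: bij_betw_def dest: inj_onD)

lemma ex_coord: obtains x where "x \<in> carrier F" "\<psi> x = t"
  using bij by (metis UNIV_I bij_betw_def imageE)

lemma complete_ord_field_if_coordinates: "complete_ord_field F"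
proof -
  note rules = add_closed mult_closed zero_in one_in coord_add coord_mult coord_zero
    coord_one coord_less coord_eq_iff algebra_simps
  have "abelian_group F"
  proof (rule abelian_groupI)
    fix x assume x: "x \<in> carrier F"
    obtain y where y: "y \<in> carrier F" "\<psi> y = - \<psi> x" by (rule ex_coord)
    then have "y \<oplus> x = \<zero>" using x by (simp add: rules)
    then show "\<exists>y\<in>carrier F. y \<oplus> x = \<zero>" using y by blast
  qed (auto simp: rules)
  moreover have "comm_monoid F" by (rule comm_monoidI) (auto simp: rules)
  ultimately have "cring F" by (intro cringI) (auto simp: rules)
  then interpret cring F .
  have inverse: "x \<in> Units F" if x: "x \<in> carrier F" "x \<noteq> \<zero>" for x
  proof -
    obtain y where y: "y \<in> carrier F" "\<psi> y = 1 / \<psi> x" by (rule ex_coord)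
    have "\<psi> x \<noteq> 0" using x by (simp add: rules)
    then have "y \<otimes> x = \<one>" "x \<otimes> y = \<one>" using x y by (simp_all add: rules)
    then show ?thesis using x y by (auto simp: Units_def)
  qed
  have "field F"
  proof (rule cring_fieldI)
    have "\<zero> \<notin> Units F"
    proof
      assume "\<zero> \<in> Units F"
      then obtain y where "y \<in> carrier F" "\<zero> \<otimes> y = \<one>" by (auto simp: Units_def)
      then have "\<psi> (\<zero> \<otimes> y) = 1" by (simp only: coord_one)
      then show False using \<open>y \<in> carrier F\<close> by (simp add: rules del: l_null)
    qed
    then show "Units F = carrier F - {\<zero>}" using inverse by auto
  qed
  then interpret field F .
  have order: "strict_total_order_on (carrier F) (rless F)" by unfold_locales (auto simp: rules)
  have "ord_ring F"
    by (intro ord_ring.intro order ring_axioms) (unfold_locales, auto simp: rules)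
  then have field: "ord_field F" by (intro ord_field.intro field_axioms)
  have complete: "\<exists>s. least_upper_bound F X s"
    if X: "X \<subseteq> carrier F" "X \<noteq> {}" "\<exists>u. upper_bound F X u" for X
  proof -
    have ub: "upper_bound F X v \<longleftrightarrow> v \<in> carrier F \<and> (\<forall>x\<in>X. \<psi> x \<le> \<psi> v)" for v
      using X(1) unfolding upper_bound_def by (auto simp: rules less_le subset_iff)
    obtain s where s: "s \<in> carrier F" "\<psi> s = Sup (\<psi> ` X)" by (rule ex_coord)
    obtain u where u: "upper_bound F X u" using X by blast
    have bdd: "bdd_above (\<psi> ` X)" using u by (auto simp: ub intro!: bdd_aboveI2)
    have "upper_bound F X s" using s bdd by (auto simp: ub intro!: cSup_upper)
    moreover have "s \<lless> v \<or> s = v" if v: "upper_bound F X v" for v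
    proof -
      have "\<psi> s \<le> \<psi> v" unfolding s(2) using X(2) v by (intro cSup_least) (auto simp: ub)
      then show ?thesis using s v by (auto simp: ub rules less_le)
    qed
    ultimately show ?thesis unfolding least_upper_bound_def by blast
  qed
  show ?thesis by (intro complete_ord_field.intro field complete_ord_field_axioms.intro complete)
qed

lemma coord_morphism: "positive_morphism (additive_osg F) real_osg \<psi>"
  by (simp add: positive_morphism_real_osg coord_add coord_less)

end

text \<open>The isomorphism is read off from the coordinates. Any other one, followed by the coordinate on \<open>G\<close>,
  is a monotone additive map with value 1 at 1, which by rigidity is the coordinate on \<open>F\<close>.\<close>

lemma coordinates_unique_iso:
  assumes F: "real_coordinates F \<phi>" and G: "real_coordinates G \<psi>"
  shows "\<exists>!f. f \<in> ord_field_isos F G"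
proof -
  interpret F: real_coordinates F \<phi> by (fact F)
  interpret G: real_coordinates G \<psi> by (fact G)
  interpret F: complete_ord_field F by (rule F.complete_ord_field_if_coordinates)
  interpret G: complete_ord_field G by (rule G.complete_ord_field_if_coordinates)
  interpret F_add: totally_ordered_semigroup "additive_osg F" by (rule F.additive_semigroup)
  define f where "f = (\<lambda>x\<in>carrier F. inv_into (carrier G) \<psi> (\<phi> x))"
  have f: "f x \<in> carrier G" "\<psi> (f x) = \<phi> x" if "x \<in> carrier F" for x
    using that G.bij by (auto simp: f_def bij_betw_def intro: inv_into_into f_inv_into_f)
  have "bij_betw (inv_into (carrier G) \<psi> \<circ> \<phi>) (carrier F) (carrier G)"
    using F.bij bij_betw_inv_into[OF G.bij] by (rule bij_betw_trans)
  then have bij: "bij_betw f (carrier F) (carrier G)"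
    by (rule bij_betw_cong[THEN iffD1, rotated]) (simp add: f_def)
  have "f \<in> ring_hom F G"
    by (rule ring_hom_memI)
      (use f in \<open>auto simp: G.coord_eq_iff G.coord_add G.coord_mult G.coord_one
        F.coord_add F.coord_mult F.coord_one\<close>)
  then have "f \<in> ord_field_isos F G"
    using bij f by (auto simp: ord_field_isos_def ring_iso_def F.coord_less G.coord_less f_def)
  moreover have "g = f" if "g \<in> ord_field_isos F G" for g
  proof
    fix x
    have g: "g \<in> extensional (carrier F)" "g \<in> ring_hom F G"
      "\<And>x y. \<lbrakk>x \<in> carrier F; y \<in> carrier F\<rbrakk> \<Longrightarrow> x \<lless>\<^bsub>F\<^esub> y \<longleftrightarrow> g x \<lless>\<^bsub>G\<^esub> g y"
      using that by (auto simp: ord_field_isos_def ring_iso_def)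
    note hom = ring_hom_closed[OF g(2)] ring_hom_add[OF g(2)] ring_hom_one[OF g(2)]
    show "g x = f x"
    proof (cases "x \<in> carrier F")
      case True
      have "positive_morphism (additive_osg F) real_osg (\<lambda>x. \<psi> (g x))"
        by (auto simp: positive_morphism_real_osg hom G.coord_add G.coord_less[symmetric] g(3))
      then have "\<psi> (g x) = \<phi> x"
        by (rule F_add.real_morphism_rigid[OF _ F.coord_morphism, where p = "\<one>\<^bsub>F\<^esub>"])
          (use True in \<open>auto simp: hom F.coord_one G.coord_one\<close>)
      then show ?thesis using True f hom by (simp add: G.coord_eq_iff)
    next
      case False then show ?thesis using g(1) by (simp add: f_def extensional_def)
    qed
  qed
  ultimately show ?thesis by blast
qed


section \<open>Complete ordered fields have real coordinates\<close>

lemma (in ord_field) zero_less_one: "\<zero> \<lless> \<one>"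
proof -
  have "\<not> \<one> \<lless> \<zero>"
  proof
    assume neg: "\<one> \<lless> \<zero>"
    then have "\<zero> \<lless> \<ominus> \<one>" using neg_iff_minus_pos by simp
    then have "\<zero> \<lless> \<ominus> \<one> \<otimes> \<ominus> \<one>" using mult_pos by simp
    then have "\<zero> \<lless> \<one>" by (simp add: l_minus r_minus)
    then show False using neg lt_asym by blast
  qed
  then show ?thesis using lt_linear[of \<one> \<zero>] by auto
qed

context complete_ord_field
begin

lemma nsum_additive_distrib:
  assumes "x \<in> carrier F" "y \<in> carrier F" "n \<ge> 1"
  shows "nsum (additive_osg F) n (x \<oplus> y) = nsum (additive_osg F) n x \<oplus> nsum (additive_osg F) n y"
proof -
  interpret add: totally_ordered_semigroup "additive_osg F" by (rule additive_semigroup)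
  have [simp]: "nsum (additive_osg F) n x \<in> carrier F" if "x \<in> carrier F" for n x
    using that add.nsum_closed by simp
  show ?thesis
    using assms(3)
  proof (induction n rule: dec_induct)
    case base then show ?case by simp
  next
    case (step n) then show ?case using assms by (simp add: nsum_Suc a_ac)
  qed
qed

text \<open>If the multiples of \<open>d\<close> are bounded, their supremum \<open>s\<close> can be lowered to \<open>s - d\<close>,
  because adding \<open>d\<close> to a multiple gives the next multiple, which is still at most \<open>s\<close>.\<close>

lemma archimedean:
  assumes d: "d \<in> carrier F" "\<zero> \<lless> d" and y: "y \<in> carrier F"
  shows "\<exists>n\<ge>1. \<not> nsum (additive_osg F) n d \<lless> y"
proof (rule ccontr)
  assume *: "\<not> ?thesis"
  interpret add: totally_ordered_semigroup "additive_osg F" by (rule additive_semigroup)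
  define X where "X = {nsum (additive_osg F) n d | n. n \<ge> 1}"
  have closed: "nsum (additive_osg F) n d \<in> carrier F" for n using add.nsum_closed d by simp
  have "upper_bound F X y" using * y by (auto simp: X_def upper_bound_def)
  moreover have "X \<subseteq> carrier F" "X \<noteq> {}" using closed by (auto simp: X_def)
  ultimately obtain s where s: "least_upper_bound F X s" using complete by blast
  then have s_closed: "s \<in> carrier F" by (simp add: least_upper_bound_def upper_bound_def)
  have shift: "s \<oplus> \<ominus> d \<lless> s"
    using add_strict_mono_left[of \<zero> d "s \<oplus> \<ominus> d"] d s_closed by (simp add: a_assoc l_neg)
  have "upper_bound F X (s \<oplus> \<ominus> d)"
    unfolding upper_bound_def
  proof (intro conjI ballI)
    fix x assume "x \<in> X"
    then obtain n where n: "n \<ge> 1" "x = nsum (additive_osg F) n d" by (auto simp: X_def)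
    have x: "x \<in> carrier F" using n closed by simp
    have "nsum (additive_osg F) (Suc n) d \<in> X" unfolding X_def by auto
    then have "x \<oplus> d \<in> X" using n by (simp add: nsum_Suc)
    then have "x \<oplus> d \<lless> s \<or> x \<oplus> d = s" using s by (auto simp: least_upper_bound_def upper_bound_def)
    moreover have "x = (x \<oplus> d) \<oplus> \<ominus> d" using x d by (simp add: a_assoc r_neg)
    ultimately show "x \<lless> s \<oplus> \<ominus> d \<or> x = s \<oplus> \<ominus> d"
      using add_strict_mono[of "x \<oplus> d" s "\<ominus> d"] x d s_closed by auto
  qed (use d s_closed in simp)
  then have "s \<lless> s \<oplus> \<ominus> d \<or> s = s \<oplus> \<ominus> d" using s by (simp add: least_upper_bound_def)
  then show False using shift lt_asym[of s "s \<oplus> \<ominus> d"] lt_irrefl[of s] s_closed d by auto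
qed

text \<open>With \<open>d = x - y > 0\<close>, an anomalous pair \<open>x, y\<close> gives an upper bound for all multiples of \<open>d\<close>:
  the bound is \<open>y\<close> for one kind of pair and \<open>- x\<close> for the other. The Archimedean property excludes
  both.\<close>

lemma additive_non_anomalous: "non_anomalous_semigroup (additive_osg F)"
proof -
  interpret add: totally_ordered_semigroup "additive_osg F" by (rule additive_semigroup)
  let ?n = "nsum (additive_osg F)"
  have closed: "?n n x \<in> carrier F" if "x \<in> carrier F" for n x using that add.nsum_closed by simp
  have "\<not> anomalous_pair (additive_osg F) x y" for x y
  proof
    assume "anomalous_pair (additive_osg F) x y"
    then have x: "x \<in> carrier F" and y: "y \<in> carrier F" and yx: "y \<lless> x"
      and anomalous: "(\<forall>n\<ge>1. ?n n x \<lless> ?n (n + 1) y) \<or> (\<forall>n\<ge>1. ?n (n + 1) x \<lless> ?n n y)"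
      by (auto simp: anomalous_pair_def)
    define d where "d = x \<oplus> \<ominus> y"
    have d: "d \<in> carrier F" "\<zero> \<lless> d"
      using add_strict_mono[of y x "\<ominus> y"] x y yx by (auto simp: d_def r_neg)
    have x_eq: "x = y \<oplus> d" using x y by (simp add: d_def a_ac r_neg l_neg)
    have n_x: "?n n x = ?n n y \<oplus> ?n n d" if "n \<ge> 1" for n
      unfolding x_eq using nsum_additive_distrib y d that by blast
    from anomalous show False
    proof
      assume *: "\<forall>n\<ge>1. ?n n x \<lless> ?n (n + 1) y"
      have "?n n d \<lless> y" if "n \<ge> 1" for n
      proof -
        have "?n n y \<oplus> ?n n d \<lless> ?n n y \<oplus> y" using * that n_x by (simp add: nsum_Suc)
        then show ?thesis using add.plus_less_cancel_left closed y d by simp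
      qed
      then show False using archimedean[OF d y] by blast
    next
      assume *: "\<forall>n\<ge>1. ?n (n + 1) x \<lless> ?n n y"
      have "?n n d \<lless> \<ominus> (y \<oplus> d)" if n: "n \<ge> 1" for n
      proof -
        have eq: "?n (n + 1) x = ?n n y \<oplus> (y \<oplus> d \<oplus> ?n n d)"
          using n n_x[of "n + 1"] y d closed by (simp add: nsum_Suc a_ac)
        then have "?n n y \<oplus> (y \<oplus> d \<oplus> ?n n d) \<lless> ?n n y \<oplus> \<zero>"
          using *[rule_format, OF n] y closed unfolding eq by simp
        then have "y \<oplus> d \<oplus> ?n n d \<lless> \<zero>"
          using add.plus_less_cancel_left[of "y \<oplus> d \<oplus> ?n n d" \<zero> "?n n y"] closed y d by simp
        then have "\<ominus> (y \<oplus> d) \<oplus> (y \<oplus> d \<oplus> ?n n d) \<lless> \<ominus> (y \<oplus> d) \<oplus> \<zero>"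
          using add_strict_mono_left closed y d by (metis a_closed a_inv_closed zero_closed)
        moreover have "\<ominus> (y \<oplus> d) \<oplus> (y \<oplus> d \<oplus> ?n n d) = ?n n d"
          using closed y d by (metis a_assoc a_closed a_inv_closed l_neg l_zero)
        ultimately show ?thesis using y d by simp
      qed
      then show False using archimedean[OF d, of "\<ominus> (y \<oplus> d)"] y d by auto
    qed
  qed
  then show ?thesis using additive_semigroup by (simp add: non_anomalous_semigroup_def)
qed

text \<open>Hoelder's embedding normalised at 1 is multiplicative by rigidity, hence takes arbitrarily small
  positive values, namely at the inverses of the multiples of 1. So the supremum of all \<open>x\<close> with
  \<open>\<psi> x \<le> t\<close> can miss \<open>t\<close> neither from below nor from above.\<close>

lemma ex_real_coordinates: "\<exists>\<psi>. real_coordinates F \<psi>"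
proof -
  interpret add: totally_ordered_semigroup "additive_osg F" by (rule additive_semigroup)
  have "\<one> \<lless> \<one> \<oplus> \<one>" using add_strict_mono[OF _ _ _ zero_less_one, of \<one>] by simp
  then obtain \<psi> where \<psi>: "positive_morphism (additive_osg F) real_osg \<psi>" and one: "\<psi> \<one> = 1"
    using hoelder_positive[OF additive_non_anomalous, of \<one>] by auto
  have add: "\<psi> (x \<oplus> y) = \<psi> x + \<psi> y" if "x \<in> carrier F" "y \<in> carrier F" for x y
    using \<psi> that by (simp add: positive_morphism_real_osg)
  have less: "x \<lless> y \<longleftrightarrow> \<psi> x < \<psi> y" if "x \<in> carrier F" "y \<in> carrier F" for x y
    using add.real_morphism_less_iff[OF \<psi>] that by simp
  have inj: "inj_on \<psi> (carrier F)" using add.real_morphism_inj[OF \<psi>] by simp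
  have mult: "\<psi> (x \<otimes> y) = \<psi> x * \<psi> y" if "x \<in> carrier F" "y \<in> carrier F" for x y
    using real_morphism_mult[OF \<psi> one] that by blast
  have zero: "\<psi> \<zero> = 0" by (rule real_morphism_zero[OF \<psi>])
  have minus: "\<psi> (\<ominus> x) = - \<psi> x" if "x \<in> carrier F" for x using real_morphism_minus[OF \<psi> that] .
  have nat: "\<exists>x\<in>carrier F. \<psi> x = real n" if "n \<ge> 1" for n
    using that add.nsum_closed[of \<one> n] add.real_morphism_nsum[of \<psi> \<one> n] add one
    by (intro bexI[of _ "nsum (additive_osg F) n \<one>"]) auto
  have small: "\<exists>u\<in>carrier F. 0 < \<psi> u \<and> \<psi> u < \<epsilon>" if "\<epsilon> > 0" for \<epsilon>
  proof -
    obtain n where n: "1 / real (Suc n) < \<epsilon>" using nat_approx_posE[OF \<open>\<epsilon> > 0\<close>] by blast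
    obtain x where x: "x \<in> carrier F" "\<psi> x = real (Suc n)" using nat[of "Suc n"] by auto
    have "x \<in> Units F" using x zero by (auto simp: field_Units)
    then have "inv x \<in> carrier F" "\<psi> (x \<otimes> inv x) = 1" using one by auto
    then have "inv x \<in> carrier F" "real (Suc n) * \<psi> (inv x) = 1" using mult x by auto
    then have "inv x \<in> carrier F" "\<psi> (inv x) = 1 / real (Suc n)" by (simp_all add: field_simps)
    then show ?thesis using n by (metis of_nat_0_less_iff zero_less_Suc zero_less_divide_1_iff)
  qed
  have "t \<in> \<psi> ` carrier F" for t
  proof -
    define X where "X = {x \<in> carrier F. \<psi> x \<le> t}"
    obtain n :: nat where n: "\<bar>t\<bar> < real n" using reals_Archimedean2 by blast
    then have "n \<ge> 1" by (cases n) auto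
    then obtain b where b: "b \<in> carrier F" "\<psi> b = real n" using nat by blast
    have "upper_bound F X b"
      using b n by (auto simp: X_def upper_bound_def less)
    moreover have "\<ominus> b \<in> X" using b n minus by (auto simp: X_def)
    moreover have "X \<subseteq> carrier F" by (auto simp: X_def)
    ultimately obtain s where s: "least_upper_bound F X s" using complete by blast
    then have s_closed: "s \<in> carrier F" by (simp add: least_upper_bound_def upper_bound_def)
    have "\<not> \<psi> s < t"
    proof
      assume "\<psi> s < t"
      then obtain u where u: "u \<in> carrier F" "0 < \<psi> u" "\<psi> u < t - \<psi> s" using small[of "t - \<psi> s"] by auto
      then have "s \<oplus> u \<in> X" using s_closed by (simp add: X_def add)
      then have "s \<oplus> u \<lless> s \<or> s \<oplus> u = s" using s by (simp add: least_upper_bound_def upper_bound_def)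
      then have "\<psi> (s \<oplus> u) \<le> \<psi> s" using s_closed u by (auto simp: less)
      then show False using s_closed u by (simp add: add)
    qed
    moreover have "\<not> t < \<psi> s"
    proof
      assume "t < \<psi> s"
      then obtain u where u: "u \<in> carrier F" "0 < \<psi> u" "\<psi> u < \<psi> s - t" using small[of "\<psi> s - t"] by auto
      then have "upper_bound F X (s \<oplus> \<ominus> u)"
        using s_closed by (auto simp: upper_bound_def X_def less add minus)
      then have "s \<lless> s \<oplus> \<ominus> u \<or> s = s \<oplus> \<ominus> u" using s by (simp add: least_upper_bound_def)
      then have "\<psi> s \<le> \<psi> (s \<oplus> \<ominus> u)" using s_closed u less[of s "s \<oplus> \<ominus> u"] by auto
      then show False using s_closed u by (simp add: add minus)
    qed
    ultimately show ?thesis using s_closed by (intro image_eqI[of _ _ s]) auto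
  qed
  then have "bij_betw \<psi> (carrier F) UNIV" using inj by (auto simp: bij_betw_def)
  then have "real_coordinates F \<psi>"
    by (intro real_coordinates.intro) (simp_all add: add less mult zero one)
  then show ?thesis by blast
qed

end


section \<open>The field structure of the terminal object\<close>

lemma additive_osg_oring_of [simp]: "additive_osg (oring_of R e m) = R"
  by (simp add: additive_osg_def oring_of_def)

lemma oring_of_simps [simp]:
  "carrier (oring_of R e m) = carrier R" "mult (oring_of R e m) = m" "one (oring_of R e m) = e"
  "zero (oring_of R e m) = szero R" "add (oring_of R e m) = splus R" "rless (oring_of R e m) = sless R"
  by (simp_all add: oring_of_def)

lemma szero_if_surjective:
  assumes tos: "totally_ordered_semigroup R"
    and \<psi>: "positive_morphism R real_osg \<psi>" and surj: "\<psi> ` carrier R = UNIV"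
  shows "szero R \<in> carrier R" "\<psi> (szero R) = 0"
proof -
  interpret totally_ordered_semigroup R by (fact tos)
  have eqI: "x = y" if "x \<in> carrier R" "y \<in> carrier R" "\<psi> x = \<psi> y" for x y
    using real_morphism_inj[OF \<psi>] that by (auto dest: inj_onD)
  have plus: "\<psi> (x \<boxplus>\<^bsub>R\<^esub> y) = \<psi> x + \<psi> y" if "x \<in> carrier R" "y \<in> carrier R" for x y
    using \<psi> that by (simp add: positive_morphism_real_osg)
  obtain o' where o': "o' \<in> carrier R" "\<psi> o' = 0" using surj by (metis UNIV_I imageE)
  have "szero R = o'"
    unfolding szero_def
  proof (rule the_equality)
    show "is_identity R o'"
      unfolding is_identity_def using o' by (auto intro!: eqI plus_closed simp: plus)
    fix z assume "is_identity R z"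
    then have "z \<in> carrier R" "z \<boxplus>\<^bsub>R\<^esub> z = z" by (auto simp: is_identity_def)
    then show "z = o'" using plus[of z z] o' by (intro eqI) auto
  qed
  then show "szero R \<in> carrier R" "\<psi> (szero R) = 0" using o' by auto
qed

text \<open>The product of the reals, carried over along \<open>\<psi>\<close>, is an ordered ring product with identity \<open>e\<close>.
  It is the only one, since \<open>\<psi>\<close> is multiplicative for every such product and injective.\<close>

lemma real_field_coordinates:
  fixes R :: "'a osg"
  assumes tos: "totally_ordered_semigroup R"
    and \<psi>: "positive_morphism R real_osg \<psi>" and surj: "\<psi> ` carrier R = UNIV"
    and e: "e \<in> carrier R" "\<psi> e = 1"
  shows "real_coordinates (real_field R e) \<psi>"
proof -
  interpret totally_ordered_semigroup R by (fact tos)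
  have inj: "inj_on \<psi> (carrier R)" by (rule real_morphism_inj[OF \<psi>])
  have plus: "\<psi> (x \<boxplus>\<^bsub>R\<^esub> y) = \<psi> x + \<psi> y" if "x \<in> carrier R" "y \<in> carrier R" for x y
    using \<psi> that by (simp add: positive_morphism_real_osg)
  define c where "c = inv_into (carrier R) \<psi>"
  have c: "c t \<in> carrier R" "\<psi> (c t) = t" for t
    using surj by (auto simp: c_def intro: inv_into_into f_inv_into_f)
  have eqI: "x = y" if "x \<in> carrier R" "y \<in> carrier R" "\<psi> x = \<psi> y" for x y
    using inj that by (auto dest: inj_onD)
  have zero: "szero R \<in> carrier R" "\<psi> (szero R) = 0"
    using szero_if_surjective[OF tos \<psi> surj] by auto
  define m where "m = (\<lambda>x\<in>carrier R. \<lambda>y\<in>carrier R. c (\<psi> x * \<psi> y))"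
  have coords: "real_coordinates (oring_of R e m) \<psi>"
    using inj surj c e zero plus real_morphism_less_iff[OF \<psi>]
    by (intro real_coordinates.intro) (auto simp: bij_betw_def m_def plus_closed)
  then interpret coords: complete_ord_field "oring_of R e m"
    by (rule real_coordinates.complete_ord_field_if_coordinates)
  have "the_product R e = m"
    unfolding the_product_def
  proof (rule the_equality, intro conjI)
    show "m \<in> carrier R \<rightarrow>\<^sub>E carrier R \<rightarrow>\<^sub>E carrier R" using c by (auto simp: m_def)
    show "ord_ring (oring_of R e m)" by unfold_locales
    fix m'
    assume "m' \<in> carrier R \<rightarrow>\<^sub>E carrier R \<rightarrow>\<^sub>E carrier R \<and> ord_ring (oring_of R e m')"
    then have ext: "m' \<in> carrier R \<rightarrow>\<^sub>E carrier R \<rightarrow>\<^sub>E carrier R"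
      and ring: "ord_ring (oring_of R e m')" by auto
    have "m' x y = m x y" for x y
    proof (cases "x \<in> carrier R \<and> y \<in> carrier R")
      case True
      then have "\<psi> (m' x y) = \<psi> x * \<psi> y"
        using ord_ring.real_morphism_mult[OF ring, of \<psi> x y] \<psi> e by simp
      moreover have "m' x y \<in> carrier R" using ext True by (auto simp: PiE_def Pi_def)
      ultimately show ?thesis using True c by (auto simp: m_def intro!: eqI)
    next
      case False
      then show ?thesis using ext by (auto simp: m_def PiE_def Pi_def extensional_def)
    qed
    then show "m' = m" by blast
  qed
  then show ?thesis using coords by (simp add: real_field_def)
qed

theorem theorem5p8:
  fixes R :: "'a osg" and r e :: 'a
  assumes "nas_terminal R r"
    and "e \<in> carrier R" and "szero R \<prec>\<^bsub>R\<^esub> e"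
  shows "complete_ord_field (real_field R e) \<and>
    (\<forall>F :: 'f oring. complete_ord_field F \<longrightarrow> (\<exists>!f. f \<in> ord_field_isos F (real_field R e)))"
proof -
  have object: "nas_object R r" using assms(1) by (simp add: nas_terminal_def)
  then interpret totally_ordered_semigroup R
    by (simp add: nas_object_def non_anomalous_semigroup_def)
  obtain \<phi> where \<phi>: "positive_morphism R real_osg \<phi>" "\<phi> r \<noteq> 0" using hoelder_embedding[OF object] .
  have surj: "\<phi> ` carrier R = UNIV" by (rule terminal_real_morphism_surj[OF assms(1) \<phi>])
  have "\<phi> e > 0"
    using szero_if_surjective[OF totally_ordered_semigroup_axioms \<phi>(1) surj] assms(2,3) \<phi>(1)
    by (auto simp: positive_morphism_real_osg)
  \<comment> \<open>The map \<open>\<phi>\<close> is tied to the base point \<open>r\<close>; rescaling makes \<open>e\<close> the unit instead.\<close>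
  define \<psi> where "\<psi> x = \<phi> x / \<phi> e" for x
  have "positive_morphism R real_osg \<psi>"
    using \<phi>(1) \<open>\<phi> e > 0\<close>
    by (auto simp: positive_morphism_real_osg \<psi>_def add_divide_distrib divide_strict_right_mono)
  moreover have "\<psi> ` carrier R = UNIV"
  proof -
    have "t \<in> \<psi> ` carrier R" for t
    proof -
      obtain x where "x \<in> carrier R" "\<phi> x = t * \<phi> e" using surj by (metis UNIV_I imageE)
      then show ?thesis using \<open>\<phi> e > 0\<close> by (intro image_eqI[of _ _ x]) (auto simp: \<psi>_def)
    qed
    then show ?thesis by blast
  qed
  moreover have "\<psi> e = 1" using \<open>\<phi> e > 0\<close> by (simp add: \<psi>_def)
  ultimately have coords: "real_coordinates (real_field R e) \<psi>"
    using real_field_coordinates[OF totally_ordered_semigroup_axioms _ _ assms(2)] by blast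
  show ?thesis
  proof (intro conjI allI impI)
    show "complete_ord_field (real_field R e)"
      by (rule real_coordinates.complete_ord_field_if_coordinates[OF coords])
    fix F :: "'f oring" assume "complete_ord_field F"
    then obtain \<chi> where "real_coordinates F \<chi>"
      using complete_ord_field.ex_real_coordinates by blast
    then show "\<exists>!f. f \<in> ord_field_isos F (real_field R e)"
      by (rule coordinates_unique_iso[OF _ coords])
  qed
qed

end
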